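(* For any prime $p$, \[ \{(r,e,d)\in\mathscr{A}(p)\mid r=2\ \text{or}\ r\nmid p-1\}=\{(r,e,d)\in\mathscr{B}(p)\mid r=2\ \text{or}\ r\nmid p-1\}. \]
   Context: Let $p$ be a prime. For an integer $r\ge 2$ let $x_1,\ldots,x_r$ be independent indeterminates over $\mathbb{F}_p$ and $f(x)=(x-x_1)\cdots(x-x_r)\in\mathbb{F}_p[x_1,\ldots,x_r][x]$. For integers $e\ge 0$ and $0\le d\le p$ write $f(x)^e=\sum_{i\ge0}c_ix^i$ (with $c_i=0$ for $i<0$) and let $M_d(f(x)^e)$ be the $d\times d$ matrix whose $(i,j)$ entry is $c_{ip+j-d-1}$. Put $\delta(x_1,\ldots,x_r)=\prod_{1\le i<j\le r}(x_i-x_j)$. $\mathscr{A}(p)$ is the set of integer triples $(r,e,d)$ with $r\ge2$, $e\ge1$, $1\le d\le p$, such that $\det M_d(f(x)^e)=\varepsilon\,\delta(x_1,\ldots,x_r)^g$ for some $\varepsilon\in\mathbb{F}_p^{\times}$ and some positive integer $g$. $\mathscr{B}(p)=\mathscr{B}_+(p)\cup\mathscr{B}_0(p)\cup\mathscr{B}_-(p)$ where $\mathscr{B}_+(p)=\{(r,e,d): 2\le r\le p,\ e=p-1,\ d=r\}$, $\mathscr{B}_0(p)=\{(r,e,d): 2\le r\le p+1,\ (p-1)/2<e\le p-1,\ r(p-1-e)\le p-1,\ d=r-1\}$, $\mathscr{B}_-(p)=\{(r,e,d): r\ge2,\ (p-1)/2<e\le p-1,\ r(p-1-e)=p-1,\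 d=r-2\}$ (integer triples). $r\nmid p-1$ means $r$ does not divide $p-1$. *)

theory Defs
  imports "HOL-Library.Poly_Mapping" "Berlekamp_Zassenhaus.Finite_Field" "Jordan_Normal_Form.Determinant"
begin

(* Multivariate polynomials over 'a in indeterminates x_0, x_1, ...:
   finitely supported maps from monomials (exponent vectors nat =>0 nat) to coefficients. *)
type_synonym 'a mpoly = "(nat \<Rightarrow>\<^sub>0 nat) \<Rightarrow>\<^sub>0 'a"

(* the indeterminate x_(i+1) of the paper (0-based here) *)
definition mvar :: "nat \<Rightarrow> 'a::zero_neq_one mpoly" where
  "mvar i = Poly_Mapping.single (Poly_Mapping.single i 1) 1"

definition mconst :: "'a::zero \<Rightarrow> 'a mpoly" where
  "mconst c = Poly_Mapping.single 0 c"

definition fpoly :: "nat \<Rightarrow> 'a::comm_ring_1 mpoly poly" where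
  "fpoly r = (\<Prod>i<r. [:- mvar i, 1:])"

definition icoeff :: "'a::zero poly \<Rightarrow> int \<Rightarrow> 'a" where
  "icoeff g k = (if k < 0 then 0 else coeff g (nat k))"

(* M_d(g): d x d matrix with (i,j) entry c_{ip+j-d-1}, 1 <= i,j <= d (shifted to 0-based indices) *)
definition Mmat :: "nat \<Rightarrow> nat \<Rightarrow> 'a::zero poly \<Rightarrow> 'a mat" where
  "Mmat p d g = mat d d (\<lambda>(i,j). icoeff g (int (i+1) * int p + int (j+1) - int d - 1))"

definition delta :: "nat \<Rightarrow> 'a::comm_ring_1 mpoly" where
  "delta r = (\<Prod>i<r. \<Prod>j\<in>{i<..<r}. mvar i - mvar j)"

(* A(p), with p = CARD('p) and F_p = 'p mod_ring *)
definition setA :: "'p::prime_card itself \<Rightarrow> (nat \<times> nat \<times> nat) set" where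
  "setA _ = {(r,e,d). r \<ge> 2 \<and> e \<ge> 1 \<and> 1 \<le> d \<and> d \<le> CARD('p) \<and>
     (\<exists>(\<epsilon>::'p mod_ring) g. \<epsilon> \<noteq> 0 \<and> g > (0::nat) \<and>
        det (Mmat CARD('p) d ((fpoly r) ^ e)) = mconst \<epsilon> * (delta r) ^ g)}"

definition setBplus :: "nat \<Rightarrow> (nat \<times> nat \<times> nat) set" where
  "setBplus p = {(r,e,d). 2 \<le> r \<and> r \<le> p \<and> e = p - 1 \<and> d = r}"

definition setB0 :: "nat \<Rightarrow> (nat \<times> nat \<times> nat) set" where
  "setB0 p = {(r,e,d). 2 \<le> r \<and> r \<le> p + 1 \<and> int p - 1 < 2 * int e \<and> int e \<le> int p - 1
      \<and> int r * (int p - 1 - int e) \<le> int p - 1 \<and> int d = int r - 1}"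

definition setBminus :: "nat \<Rightarrow> (nat \<times> nat \<times> nat) set" where
  "setBminus p = {(r,e,d). 2 \<le> r \<and> int p - 1 < 2 * int e \<and> int e \<le> int p - 1
      \<and> int r * (int p - 1 - int e) = int p - 1 \<and> int d = int r - 2}"

definition setB :: "nat \<Rightarrow> (nat \<times> nat \<times> nat) set" where
  "setB p = setBplus p \<union> setB0 p \<union> setBminus p"

end

theory Submission
  imports "HOL-Algebra.Algebraic_Closure_Type" Defs
begin

text \<open>Up to reversing columns, the matrix of f^e sends a polynomial h of degree less than d to the
  coefficients of f^e h at X^(kp-1), for k = 1, ..., d.

  If the determinant is a nonzero constant times a positive power of delta, then it is nonzero at
  every tuple of distinct roots. A root 0 kills the first row unless e < p, and the last row
  vanishes unless d(p-1) <= re; hence d <= r, with equality only for e = p-1. At f = X^r - 1 (for p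
  not dividing r) every row needs an entry, so multiplication by p preserves {1, ..., d} modulo r,
  which forces d = r-1 as p is not 1 modulo r. The case of p dividing r uses f = X^r - X and
  degrees; comparing degrees also gives g = 2e+1-p for d = r-1.

  Conversely let d = r-1 and g = 2e+1-p. Weighting the rows by powers of x_i^p and adding them to
  the first one annihilates multiples of (X-x_i)^p, so expanding (X-x_j)^e around x_i shows that
  (x_i-x_j)^g divides the determinant. Hence delta^g divides it, and both have the same degree. The
  constant is nonzero because for f = X^r - 1 or f = X^r - X the matrix has exactly one nonzero
  entry in each row and column. The case e = p-1, d = r reduces to d = r-1 by expanding along the
  last row; the third family has r dividing p-1 and r > 2.\<close>

section \<open>Evaluation of multivariate polynomials\<close>

definition monom_eval :: "(nat \<Rightarrow> 'b::comm_ring_1) \<Rightarrow> (nat \<Rightarrow>\<^sub>0 nat) \<Rightarrow> 'b" where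
  "monom_eval v m = (\<Prod>i\<in>Poly_Mapping.keys m. v i ^ Poly_Mapping.lookup m i)"

text \<open>The coefficient map \<open>h\<close> stays arbitrary because three targets occur: the
  polynomial ring itself, univariate polynomials over it, and the algebraic closure of the base
  field.\<close>

definition insertion :: "('a::zero \<Rightarrow> 'b::comm_ring_1) \<Rightarrow> (nat \<Rightarrow> 'b) \<Rightarrow> 'a mpoly \<Rightarrow> 'b" where
  "insertion h v P = (\<Sum>m\<in>Poly_Mapping.keys P. h (Poly_Mapping.lookup P m) * monom_eval v m)"

lemma monom_eval_superset:
  assumes "finite S" "Poly_Mapping.keys m \<subseteq> S"
  shows "monom_eval v m = (\<Prod>i\<in>S. v i ^ Poly_Mapping.lookup m i)"
  unfolding monom_eval_def
  by (rule prod.mono_neutral_left) (use assms in \<open>auto simp: in_keys_iff\<close>)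

lemma monom_eval_0 [simp]: "monom_eval v 0 = 1"
  by (simp add: monom_eval_def)

lemma monom_eval_add: "monom_eval v (m + n) = monom_eval v m * monom_eval v n"
proof -
  let ?S = "Poly_Mapping.keys m \<union> Poly_Mapping.keys n"
  have "Poly_Mapping.keys (m + n) \<subseteq> ?S"
    by (rule Poly_Mapping.keys_add)
  then show ?thesis
    by (simp add: monom_eval_superset[of ?S] lookup_add power_add prod.distrib)
qed

lemma monom_eval_single: "monom_eval v (Poly_Mapping.single i n) = v i ^ n"
  by (simp add: monom_eval_def)

lemma monom_eval_dvd_diff:
  assumes "\<And>i. q dvd v i - w i"
  shows "q dvd monom_eval v m - monom_eval w m"
proof -
  have pw: "q dvd v i ^ n - w i ^ n" for i n
  proof (induction n)
    case (Suc n)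
    have "v i ^ Suc n - w i ^ Suc n = v i * (v i ^ n - w i ^ n) + (v i - w i) * w i ^ n"
      by (simp add: algebra_simps)
    then show ?case using Suc assms[of i] by simp
  qed simp
  have "q dvd (\<Prod>i\<in>S. v i ^ f i) - (\<Prod>i\<in>S. w i ^ f i)" if "finite S" for S f
    using that
  proof (induction S)
    case (insert x S)
    have "(\<Prod>i\<in>insert x S. v i ^ f i) - (\<Prod>i\<in>insert x S. w i ^ f i) =
       v x ^ f x * ((\<Prod>i\<in>S. v i ^ f i) - (\<Prod>i\<in>S. w i ^ f i)) + (v x ^ f x - w x ^ f x) * (\<Prod>i\<in>S. w i ^ f i)"
      using insert.hyps by (simp add: algebra_simps)
    then show ?case
      by (simp only:) (intro dvd_add dvd_mult dvd_mult2 insert.IH pw)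
  qed simp
  then show ?thesis by (simp add: monom_eval_def)
qed

lemma mpoly_sum_singles:
  "P = (\<Sum>m\<in>Poly_Mapping.keys P. Poly_Mapping.single m (Poly_Mapping.lookup P m))"
  by (rule poly_mapping_eqI)
    (auto simp: lookup_sum lookup_single when_def in_keys_iff sum.delta)

context
  fixes h :: "'a::comm_ring_1 \<Rightarrow> 'b::comm_ring_1" and v :: "nat \<Rightarrow> 'b"
  assumes h: "comm_ring_hom h"
begin

interpretation h: comm_ring_hom h by (rule h)

lemma insertion_superset:
  assumes "finite S" "Poly_Mapping.keys P \<subseteq> S"
  shows "insertion h v P = (\<Sum>m\<in>S. h (Poly_Mapping.lookup P m) * monom_eval v m)"
  unfolding insertion_def
  by (rule sum.mono_neutral_left) (use assms in \<open>auto simp: in_keys_iff\<close>)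

lemma insertion_0: "insertion h v 0 = 0"
  by (simp add: insertion_def)

lemma insertion_single: "insertion h v (Poly_Mapping.single m c) = h c * monom_eval v m"
  by (simp add: insertion_def)

lemma insertion_add: "insertion h v (P + Q) = insertion h v P + insertion h v Q"
proof -
  let ?S = "Poly_Mapping.keys P \<union> Poly_Mapping.keys Q"
  have "Poly_Mapping.keys (P + Q) \<subseteq> ?S"
    by (rule Poly_Mapping.keys_add)
  then show ?thesis
    by (simp add: insertion_superset[of ?S] lookup_add h.hom_add distrib_right sum.distrib)
qed

lemma insertion_sum: "insertion h v (sum f A) = (\<Sum>x\<in>A. insertion h v (f x))"
  by (induction A rule: infinite_finite_induct) (auto simp: insertion_0 insertion_add)

lemma insertion_mult: "insertion h v (P * Q) = insertion h v P * insertion h v Q"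
proof -
  let ?c = "Poly_Mapping.lookup P" and ?d = "Poly_Mapping.lookup Q"
  let ?K = "Poly_Mapping.keys P" and ?L = "Poly_Mapping.keys Q"
  have "P * Q = (\<Sum>m\<in>?K. Poly_Mapping.single m (?c m)) * (\<Sum>n\<in>?L. Poly_Mapping.single n (?d n))"
    by (simp flip: mpoly_sum_singles)
  also have "\<dots> = (\<Sum>m\<in>?K. \<Sum>n\<in>?L. Poly_Mapping.single (m + n) (?c m * ?d n))"
    by (simp add: sum_product mult_single)
  finally have "insertion h v (P * Q) =
      (\<Sum>m\<in>?K. \<Sum>n\<in>?L. h (?c m * ?d n) * monom_eval v (m + n))"
    by (simp add: insertion_sum insertion_single)
  also have "\<dots> = insertion h v P * insertion h v Q"
    by (simp add: insertion_def sum_product h.hom_mult monom_eval_add mult_ac)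
  finally show ?thesis .
qed

lemma insertion_mconst: "insertion h v (mconst c) = h c"
  by (simp add: mconst_def insertion_single)

lemma insertion_mvar: "insertion h v (mvar i) = v i"
  by (simp add: mvar_def insertion_single monom_eval_single)

lemma insertion_hom: "comm_ring_hom (insertion h v)"
proof unfold_locales
  show "insertion h v 1 = 1"
    using insertion_mconst[of 1] by (simp add: mconst_def)
qed (simp_all add: insertion_0 insertion_add insertion_mult)

text \<open>Polynomial expressions respect congruences modulo \<open>q\<close>. With q = x_i - x_j
  this yields a factor theorem for differences of indeterminates.\<close>

lemma insertion_dvd_diff:
  assumes "\<And>i. q dvd v i - w i"
  shows "q dvd insertion h v P - insertion h w P"
proof -
  have "insertion h v P - insertion h w P =
    (\<Sum>m\<in>Poly_Mapping.keys P. h (Poly_Mapping.lookup P m) * (monom_eval v m - monom_eval w m))"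
    by (simp add: insertion_def sum_subtractf right_diff_distrib)
  also have "q dvd \<dots>"
    by (intro dvd_sum dvd_mult monom_eval_dvd_diff assms)
  finally show ?thesis .
qed

lemma hom_insertion:
  assumes "comm_ring_hom \<psi>"
  shows "\<psi> (insertion h v P) = insertion (\<psi> \<circ> h) (\<psi> \<circ> v) P"
proof -
  interpret psi: comm_ring_hom \<psi> by fact
  show ?thesis
    by (simp add: insertion_def monom_eval_def psi.hom_sum psi.hom_mult psi.hom_prod psi.hom_power)
qed

end

lemma mconst_hom: "comm_ring_hom (mconst :: 'a::comm_ring_1 \<Rightarrow> 'a mpoly)"
  by unfold_locales (simp_all add: mconst_def single_add mult_single)

lemma monom_eval_mvar: "monom_eval mvar m = (Poly_Mapping.single m 1 :: 'a::comm_ring_1 mpoly)"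
proof -
  have pw: "mvar i ^ n = (Poly_Mapping.single (Poly_Mapping.single i n) 1 :: 'a mpoly)" for i n
  proof (induction n)
    case (Suc n)
    have "mvar i ^ Suc n = (Poly_Mapping.single (Poly_Mapping.single i 1 + Poly_Mapping.single i n) (1 * 1) :: 'a mpoly)"
      unfolding power_Suc Suc.IH mult_single[symmetric] by (simp add: mvar_def)
    also have "Poly_Mapping.single i 1 + Poly_Mapping.single i n = Poly_Mapping.single i (Suc n)"
      by (simp flip: single_add)
    finally show ?case by simp
  qed simp
  have pr: "(\<Prod>i\<in>S. Poly_Mapping.single (k i) 1) = (Poly_Mapping.single (\<Sum>i\<in>S. k i) 1 :: 'a mpoly)"
    for S and k :: "nat \<Rightarrow> nat \<Rightarrow>\<^sub>0 nat"
    by (induction S rule: infinite_finite_induct) (auto simp: mult_single)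
  have "m = (\<Sum>i\<in>Poly_Mapping.keys m. Poly_Mapping.single i (Poly_Mapping.lookup m i))"
    by (rule poly_mapping_eqI)
      (auto simp: lookup_sum lookup_single when_def in_keys_iff sum.delta)
  then show ?thesis
    by (simp add: monom_eval_def pw pr)
qed

lemma insertion_mconst_mvar: "insertion mconst mvar P = P"
  by (simp add: insertion_def monom_eval_mvar mconst_def mult_single flip: mpoly_sum_singles)

lemma insertion_mconst_zero: "insertion mconst (\<lambda>_. 0) P = mconst (Poly_Mapping.lookup P 0)"
proof -
  have ev: "monom_eval (\<lambda>_. 0) m = (0 :: 'a mpoly)" if m: "m \<noteq> 0" for m
  proof -
    from m obtain i where i: "i \<in> Poly_Mapping.keys m"
      by (metis all_not_in_conv keys_eq_empty)
    then have "(0 :: 'a mpoly) ^ Poly_Mapping.lookup m i = 0"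
      by (simp add: in_keys_iff zero_power)
    with i show ?thesis
      unfolding monom_eval_def by (meson finite_keys prod_zero)
  qed
  have "insertion mconst (\<lambda>_. 0 :: 'a mpoly) P =
      (\<Sum>m\<in>Poly_Mapping.keys P. if m = 0 then mconst (Poly_Mapping.lookup P 0) else 0)"
    unfolding insertion_def by (rule sum.cong) (auto simp: ev)
  also have "\<dots> = mconst (Poly_Mapping.lookup P 0)"
    by (simp add: sum.delta in_keys_iff mconst_def)
  finally show ?thesis .
qed

lemma mvar_eq_iff [simp]: "mvar i = (mvar j :: 'a::comm_ring_1 mpoly) \<longleftrightarrow> i = j"
proof
  assume "mvar i = (mvar j :: 'a mpoly)"
  then have "Poly_Mapping.keys (mvar i :: 'a mpoly) = Poly_Mapping.keys (mvar j :: 'a mpoly)"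
    by simp
  then have "Poly_Mapping.single i (1::nat) = Poly_Mapping.single j 1"
    by (simp add: mvar_def)
  then have "Poly_Mapping.keys (Poly_Mapping.single i (1::nat)) = Poly_Mapping.keys (Poly_Mapping.single j (1::nat))"
    by simp
  then show "i = j" by simp
qed simp

text \<open>Transfers characteristic p to the ring of the generic roots, where the additivity of the
  p-th power is applied to linear factors.\<close>

lemma CHAR_mpoly [simp]: "CHAR('a::comm_ring_1 mpoly) = CHAR('a)"
proof (rule CHAR_eqI)
  interpret comm_ring_hom "mconst :: 'a \<Rightarrow> 'a mpoly" by (rule mconst_hom)
  have *: "of_nat n = (mconst (of_nat n) :: 'a mpoly)" for n
    by (simp add: hom_of_nat)
  show "of_nat CHAR('a) = (0 :: 'a mpoly)"
    by (simp add: *)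
  show "CHAR('a) dvd n" if "of_nat n = (0 :: 'a mpoly)" for n
  proof -
    have "Poly_Mapping.lookup (mconst (of_nat n) :: 'a mpoly) 0 = 0"
      using that by (simp add: *)
    then have "of_nat n = (0 :: 'a)"
      unfolding mconst_def by (metis lookup_single_eq)
    then show ?thesis
      by (simp add: of_nat_eq_0_iff_char_dvd)
  qed
qed

section \<open>The determinant at a tuple of roots\<close>

text \<open>An arbitrary tuple of roots in any commutative ring lets the same facts serve the
  generic roots \<open>mvar\<close> and all specialisations.\<close>

definition rpoly :: "(nat \<Rightarrow> 'a::comm_ring_1) \<Rightarrow> nat \<Rightarrow> 'a poly" where
  "rpoly a r = (\<Prod>i<r. [:- a i, 1:])"

definition vdm :: "(nat \<Rightarrow> 'a::comm_ring_1) \<Rightarrow> nat \<Rightarrow> 'a" where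
  "vdm a r = (\<Prod>i<r. \<Prod>j\<in>{i<..<r}. a i - a j)"

definition Mdet :: "nat \<Rightarrow> nat \<Rightarrow> nat \<Rightarrow> nat \<Rightarrow> (nat \<Rightarrow> 'a::comm_ring_1) \<Rightarrow> 'a" where
  "Mdet p r e d a = det (Mmat p d (rpoly a r ^ e))"

lemma fpoly_eq_rpoly: "fpoly r = rpoly mvar r"
  by (simp add: fpoly_def rpoly_def)

lemma delta_eq_vdm: "delta r = vdm mvar r"
  by (simp add: delta_def vdm_def)

lemma vdm_eq_0_iff:
  fixes a :: "nat \<Rightarrow> 'a::idom"
  shows "vdm a r = 0 \<longleftrightarrow> \<not> inj_on a {..<r}"
proof
  assume "vdm a r = 0"
  then obtain i j where "i < j" "j < r" "a i = a j"
    by (auto simp: vdm_def)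
  then show "\<not> inj_on a {..<r}"
    by (metis inj_onD lessThan_iff less_trans nat_neq_iff)
next
  assume "\<not> inj_on a {..<r}"
  then obtain i j where ij: "i < r" "j < r" "i \<noteq> j" "a i = a j"
    by (auto simp: inj_on_def)
  have "vdm a r = 0" if "i < j" "j < r" "a i = a j" for i j
    unfolding vdm_def using that by (intro prod_zero) force+
  from this[of i j] this[of j i] ij show "vdm a r = 0"
    by (cases "i < j") auto
qed

lemma degree_rpoly: "degree (rpoly a r) = r" and monic_rpoly: "coeff (rpoly a r) r = 1"
proof -
  have "degree (rpoly a r) = r \<and> coeff (rpoly a r) r = 1"
  proof (induction r)
    case 0
    show ?case by (simp add: rpoly_def)
  next
    case (Suc r)
    have S: "rpoly a (Suc r) = [:- a r, 1:] * rpoly a r"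
      by (simp add: rpoly_def mult.commute)
    have c: "coeff (rpoly a (Suc r)) (Suc r) = 1"
      unfolding S using Suc by (simp add: coeff_eq_0)
    moreover have "degree (rpoly a (Suc r)) \<le> Suc r"
      unfolding S using Suc degree_mult_le[of "[:- a r, 1:]" "rpoly a r"] by simp
    ultimately show ?case
      by (metis le_antisym le_degree zero_neq_one)
  qed
  then show "degree (rpoly a r) = r" "coeff (rpoly a r) r = 1" by auto
qed

lemma degree_rpoly_power_le: "degree (rpoly a r ^ e) \<le> r * e"
  using degree_power_le[of "rpoly a r" e] by (simp add: degree_rpoly)

lemma Mmat_carrier [simp]: "Mmat p d F \<in> carrier_mat d d"
  by (simp add: Mmat_def)

lemma Mmat_index:
  assumes "i < d" "j < d"
  shows "Mmat p d F $$ (i,j) = icoeff F (int (Suc i * p + j) - int d)"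
  using assms by (simp add: Mmat_def algebra_simps)

text \<open>Column \<open>j\<close> reads X^(d-1-j) F at the exponents kp - 1. In this form a row
  combination is a linear functional on polynomials, and the negative indices become coefficients
  below the shift.\<close>

lemma Mmat_index_monom:
  fixes F :: "'a::comm_ring_1 poly"
  assumes "i < d" "j < d" "p > 0"
  shows "Mmat p d F $$ (i,j) = coeff (monom 1 (d - 1 - j) * F) (Suc i * p - 1)"
proof -
  define q where "q = Suc i * p"
  have p: "q \<ge> 1" using assms by (simp add: q_def)
  show ?thesis
  proof (cases "d \<le> q + j")
    case True
    then have "nat (int (q + j) - int d) = q - 1 - (d - 1 - j)" "d - 1 - j \<le> q - 1"
      using assms(1,2) p by linarith+
    moreover from True have "\<not> int (q + j) - int d < 0" by linarith
    ultimately show ?thesis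
      unfolding Mmat_index[OF assms(1,2)] q_def[symmetric] icoeff_def
      by (simp add: coeff_monom_mult)
  next
    case False
    then have "int (q + j) - int d < 0" "\<not> d - 1 - j \<le> q - 1"
      using assms(1,2) p by linarith+
    then show ?thesis
      unfolding Mmat_index[OF assms(1,2)] q_def[symmetric] icoeff_def
      by (simp add: coeff_monom_mult)
  qed
qed

lemma hom_Mdet:
  assumes "comm_ring_hom h"
  shows "h (Mdet p r e d a) = Mdet p r e d (\<lambda>i. h (a i))"
proof -
  interpret h: comm_ring_hom h by fact
  interpret hp: map_poly_comm_ring_hom h ..
  have R: "map_poly h (rpoly a r ^ e) = rpoly (\<lambda>i. h (a i)) r ^ e"
    by (simp add: rpoly_def hp.hom_power hp.hom_prod h.hom_uminus)
  have "map_mat h (Mmat p d F) = Mmat p d (map_poly h F)" for F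
    by (rule eq_matI) (auto simp: Mmat_def icoeff_def)
  then have "map_mat h (Mmat p d (rpoly a r ^ e)) = Mmat p d (rpoly (\<lambda>i. h (a i)) r ^ e)"
    by (simp add: R)
  then show ?thesis
    unfolding Mdet_def by (metis h.hom_det)
qed

lemma hom_vdm:
  assumes "comm_ring_hom h"
  shows "h (vdm a r) = vdm (\<lambda>i. h (a i)) r"
proof -
  interpret h: comm_ring_hom h by fact
  show ?thesis by (simp add: vdm_def h.hom_prod h.hom_minus)
qed

section \<open>Homogeneity of the determinant and of the Vandermonde product\<close>

lemma det_scale_rows:
  "det (mat n n (\<lambda>(i,j). u i * A i j)) = (\<Prod>i<n. u i) * det (mat n n (\<lambda>(i,j). A i j :: 'a::comm_ring_1))"
proof -
  have "det (mat n n (\<lambda>(i,j). u i * A i j)) =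
     (\<Sum>q | q permutes {0..<n}. signof q * (\<Prod>i = 0..<n. u i * A i (q i)))"
    by (subst det_def'[of _ n]) (auto intro!: sum.cong prod.cong simp: permutes_def)
  also have "\<dots> = (\<Prod>i<n. u i) * (\<Sum>q | q permutes {0..<n}. signof q * (\<Prod>i = 0..<n. A i (q i)))"
    by (simp add: prod.distrib sum_distrib_left mult_ac atLeast0LessThan)
  also have "(\<Sum>q | q permutes {0..<n}. signof q * (\<Prod>i = 0..<n. A i (q i))) = det (mat n n (\<lambda>(i,j). A i j))"
    by (subst det_def'[of _ n]) (auto intro!: sum.cong prod.cong simp: permutes_def)
  finally show ?thesis .
qed

lemma det_scale_cols:
  "det (mat n n (\<lambda>(i,j). u j * A i j)) = (\<Prod>j<n. u j) * det (mat n n (\<lambda>(i,j). A i j :: 'a::comm_ring_1))"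
proof -
  have T: "det (mat n n (\<lambda>(i,j). B i j)) = det (mat n n (\<lambda>(i,j). B j i))" for B :: "nat \<Rightarrow> nat \<Rightarrow> 'a"
    by (subst det_transpose[symmetric, of _ n]) (auto intro!: arg_cong[of _ _ det])
  show ?thesis
    by (subst (1 2) T) (rule det_scale_rows)
qed

text \<open>The coefficient of X^n is homogeneous of degree re - n in the roots: substituting tX for
  X extracts a factor t from each of the re linear factors. The factor t^n on the left avoids
  subtracting exponents.\<close>

lemma coeff_rpoly_scale:
  "t ^ n * coeff (rpoly (\<lambda>i. t * a i) r ^ e) n = t ^ (r * e) * coeff (rpoly a r ^ e) n"
proof -
  have "pcompose (rpoly (\<lambda>i. t * a i) r ^ e) [:0, t:] = smult (t ^ (r * e)) (rpoly a r ^ e)"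
  proof -
    have "pcompose (rpoly (\<lambda>i. t * a i) r) [:0, t:] = (\<Prod>i<r. smult t [:- a i, 1:])"
      unfolding rpoly_def pcompose_prod
      by (rule prod.cong) (auto simp: pcompose_pCons)
    also have "\<dots> = smult (t ^ r) (rpoly a r)"
      by (simp only: rpoly_def prod_smult prod_constant card_lessThan)
    finally show ?thesis
      by (simp add: pcompose_hom.hom_power smult_power power_mult)
  qed
  then show ?thesis
    by (metis coeff_pcompose_linear coeff_smult)
qed

text \<open>Exponents of t that appear when all roots are multiplied by t: kp for the k-th row, d -
  j for column j, and one for each pair of roots.\<close>

definition wt_row :: "nat \<Rightarrow> nat \<Rightarrow> nat" where "wt_row p d = (\<Sum>i<d. Suc i * p)"
definition wt_col :: "nat \<Rightarrow> nat" where "wt_col d = (\<Sum>j<d. d - j)"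
definition wt_vdm :: "nat \<Rightarrow> nat" where "wt_vdm r = (\<Sum>i<r. card {i<..<r})"

lemma wt_row: "2 * wt_row p d = p * d * (d + 1)"
  unfolding wt_row_def by (induction d) (auto simp: algebra_simps)

lemma wt_col: "2 * wt_col d = d * (d + 1)"
proof -
  have "wt_col d = (\<Sum>j<d. Suc j)"
    unfolding wt_col_def
    by (rule sum.reindex_bij_witness[of _ "\<lambda>j. d - 1 - j" "\<lambda>j. d - 1 - j"]) auto
  also have "2 * \<dots> = d * (d + 1)" by (induction d) auto
  finally show ?thesis .
qed

lemma wt_vdm: "2 * wt_vdm r = r * (r - 1)"
proof -
  have "wt_vdm r = (\<Sum>j<r. j)"
    unfolding wt_vdm_def
    by (rule sum.reindex_bij_witness[of _ "\<lambda>j. r - 1 - j" "\<lambda>j. r - 1 - j"]) auto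
  also have "2 * \<dots> = r * (r - 1)"
  proof (induction r)
    case (Suc r) then show ?case by (cases r) auto
  qed simp
  finally show ?thesis .
qed

lemma vdm_scale: "vdm (\<lambda>i. t * a i) r = t ^ wt_vdm r * vdm a r"
proof -
  have "vdm (\<lambda>i. t * a i) r = (\<Prod>i<r. \<Prod>j\<in>{i<..<r}. t * (a i - a j))"
    by (simp add: vdm_def algebra_simps)
  then show ?thesis
    by (simp add: prod.distrib vdm_def wt_vdm_def power_sum)
qed

text \<open>With rows counted from 1 and columns from 0, the entry at (k, j) has degree re + (d - j)
  - kp: a constant plus a column term minus a row term. Hence the determinant is
  homogeneous.\<close>

lemma Mdet_scale:
  "t ^ wt_row p d * Mdet p r e d (\<lambda>i. t * a i) = t ^ (r * e * d + wt_col d) * Mdet p r e d a"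
proof -
  let ?F = "rpoly (\<lambda>i. t * a i) r ^ e" and ?G = "rpoly a r ^ e"
  have ent: "t ^ q * icoeff ?F (int (q + j) - int d) =
      t ^ (r * e) * (t ^ (d - j) * icoeff ?G (int (q + j) - int d))" if "j < d" for q j
  proof (cases "d \<le> q + j")
    case True
    define n where "n = q + j - d"
    have n: "q = n + (d - j)" "nat (int (q + j) - int d) = n" "\<not> int (q + j) - int d < 0"
      using True that unfolding n_def by linarith+
    have "t ^ q * coeff ?F n = t ^ (d - j) * (t ^ n * coeff ?F n)"
      unfolding n(1) by (simp add: power_add mult_ac)
    also have "\<dots> = t ^ (r * e) * (t ^ (d - j) * coeff ?G n)"
      by (simp only: coeff_rpoly_scale mult_ac)
    finally show ?thesis
      using n(3) unfolding icoeff_def n(2) by simp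
  next
    case False
    then have "int (q + j) - int d < 0" by linarith
    then show ?thesis unfolding icoeff_def by simp
  qed
  let ?c = "\<lambda>F i j. icoeff F (int (Suc i * p + j) - int d)"
  have M: "Mmat p d F = mat d d (\<lambda>(i,j). ?c F i j)" for F :: "'a poly"
    by (rule eq_matI) (auto simp: Mmat_index, simp_all add: Mmat_def)
  have "mat d d (\<lambda>(i,j). t ^ (Suc i * p) * ?c ?F i j) =
      mat d d (\<lambda>(i,j). t ^ (r * e) * (t ^ (d - j) * ?c ?G i j))"
    by (rule cong_mat) (simp_all only: split_conv ent)
  then have "det (mat d d (\<lambda>(i,j). t ^ (Suc i * p) * ?c ?F i j)) =
      det (mat d d (\<lambda>(i,j). t ^ (r * e) * (t ^ (d - j) * ?c ?G i j)))"
    by simp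
  then have "(\<Prod>i<d. t ^ (Suc i * p)) * det (Mmat p d ?F) =
      (\<Prod>i<d. t ^ (r * e)) * ((\<Prod>j<d. t ^ (d - j)) * det (Mmat p d ?G))"
    by (simp only: det_scale_rows[where A = "?c ?F"] det_scale_rows[where A = "\<lambda>i j. t ^ (d - j) * ?c ?G i j"]
        det_scale_cols[where A = "?c ?G"] flip: M)
  moreover have "(\<Prod>i<d. t ^ (Suc i * p)) = t ^ wt_row p d" "(\<Prod>j<d. t ^ (d - j)) = t ^ wt_col d"
    by (simp_all only: wt_row_def wt_col_def power_sum)
  moreover have "(\<Prod>i<d. t ^ (r * e)) = t ^ (r * e * d)"
    by (simp only: prod_constant card_lessThan power_mult)
  ultimately show ?thesis
    by (simp add: Mdet_def power_add mult_ac)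
qed

section \<open>Divisibility by the differences\<close>

text \<open>The coefficient of (X^p - w)H at X^((k+1)p-1) is that of H at kp - 1 minus w times that
  at (k+1)p - 1, so the weights w^k make the sum telescope.\<close>

lemma telescoping_row_sum:
  fixes w :: "'a::comm_ring_1"
  assumes "p > 0" "d > 0" "coeff H (d * p - 1) = 0"
  shows "(\<Sum>k<d. w ^ k * coeff ((monom 1 p - [:w:]) * H) (Suc k * p - 1)) = 0"
proof -
  \<comment> \<open>The value 0 at k = 0 stands for the coefficient of index -1, which truncated
    subtraction would turn into index 0.\<close>
  define b where "b k = (if k = 0 then 0 else w ^ k * coeff H (k * p - 1))" for k
  have "w ^ k * coeff ((monom 1 p - [:w:]) * H) (Suc k * p - 1) = b k - b (Suc k)" for k
  proof -
    have "coeff (monom 1 p * H) (Suc k * p - 1) = (if k = 0 then 0 else coeff H (k * p - 1))"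
    proof (cases k)
      case (Suc l)
      then have "p \<le> Suc k * p - 1" "Suc k * p - 1 - p = k * p - 1"
        using assms(1) by (simp_all add: Suc_le_eq)
      then show ?thesis using Suc by (simp add: coeff_monom_mult)
    qed (use assms(1) in \<open>simp add: coeff_monom_mult\<close>)
    then show ?thesis
      by (simp add: b_def left_diff_distrib right_diff_distrib algebra_simps)
  qed
  then have "(\<Sum>k<d. w ^ k * coeff ((monom 1 p - [:w:]) * H) (Suc k * p - 1)) = b 0 - b d"
    by (simp add: sum_lessThan_telescope')
  then show ?thesis
    using assms by (simp add: b_def)
qed

text \<open>The constant is left as \<open>- ((- s) ^ p)\<close>, which equals s^p in characteristic
  p, so that no case split on the parity of p arises.\<close>

lemma linear_power_char:
  fixes s :: "'a::comm_ring_1"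
  assumes "CHAR('a) = p" "prime p"
  shows "[:-s, 1:] ^ p = monom 1 p - [:- ((- s) ^ p):]"
proof -
  have "[:-s, 1:] = monom 1 1 + [:-s:]"
    by (simp add: monom_altdef)
  then have "[:-s, 1:] ^ p = monom 1 1 ^ p + [:-s:] ^ p"
    using assms by (metis freshmans_dream semiring_char_poly)
  then show ?thesis
    by (simp add: monom_power poly_const_pow)
qed

text \<open>Expanding X - b around s gives terms with (X-s)^(e+k) (s-b)^(e-k). If e - k < g, then e
  + k \<ge> p by the choice of g, and the term is a multiple of (X-s)^p = X^p - s^p, which the
  weighted sum annihilates.\<close>

lemma dvd_row_combination:
  fixes s b :: "'a::comm_ring_1"
  assumes p: "CHAR('a) = p" "prime p" and d: "d > 0"
    and deg: "2 * e + degree H < Suc d * p - 1" and g: "g + p \<le> 2 * e + 1"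
  shows "(s - b) ^ g dvd
    (\<Sum>k<d. (- ((- s) ^ p)) ^ k * coeff (([:-s, 1:] * [:-b, 1:]) ^ e * H) (Suc k * p - 1))"
proof -
  have p0: "p > 0" using p(2) by (simp add: prime_gt_0_nat)
  define Y where "Y = [:-s, 1:]"
  define C where "C = [:s - b:]"
  define L where "L F = (\<Sum>k<d. (- ((- s) ^ p)) ^ k * coeff F (Suc k * p - 1))" for F
  have L_sum: "L (sum f A) = (\<Sum>x\<in>A. L (f x))" if "finite A" for f :: "nat \<Rightarrow> 'a poly" and A
    unfolding L_def coeff_sum sum_distrib_left by (rule sum.swap)
  have "[:-b, 1:] = Y + C" by (simp add: Y_def C_def)
  then have "(Y * [:-b, 1:]) ^ e * H = Y ^ e * (Y + C) ^ e * H"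
    by (simp add: power_mult_distrib)
  also have "\<dots> = (\<Sum>k\<le>e. Y ^ e * (of_nat (e choose k) * Y ^ k * C ^ (e - k)) * H)"
    by (simp add: binomial_ring sum_distrib_left sum_distrib_right)
  finally have "L ((Y * [:-b, 1:]) ^ e * H) =
      (\<Sum>k\<le>e. L (Y ^ e * (of_nat (e choose k) * Y ^ k * C ^ (e - k)) * H))"
    by (simp only: L_sum finite_atMost)
  also have "(s - b) ^ g dvd \<dots>"
  proof (intro dvd_sum)
    fix k assume k: "k \<in> {..e}"
    let ?T = "Y ^ e * (of_nat (e choose k) * Y ^ k * C ^ (e - k)) * H"
    show "(s - b) ^ g dvd L ?T"
    proof (cases "g \<le> e - k")
      case True
      have "?T = smult ((s - b) ^ (e - k)) (Y ^ e * of_nat (e choose k) * Y ^ k * H)"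
        by (simp add: C_def poly_const_pow mult_ac)
      moreover have "(s - b) ^ g dvd (s - b) ^ (e - k)"
        using True by (rule le_imp_power_dvd)
      ultimately show ?thesis
        unfolding L_def by (intro dvd_sum dvd_mult) simp
    next
      case False
      then have ek: "p \<le> e + k" using g k by auto
      define H' where "H' = Y ^ (e + k - p) * (of_nat (e choose k) * (C ^ (e - k) * H))"
      have "?T = Y ^ p * H'"
      proof -
        have "?T = Y ^ (e + k) * (of_nat (e choose k) * (C ^ (e - k) * H))"
          by (simp only: power_add mult_ac)
        also have "Y ^ (e + k) = Y ^ p * Y ^ (e + k - p)" using ek by (simp flip: power_add)
        finally show ?thesis by (simp only: H'_def mult_ac)
      qed
      then have T: "?T = (monom 1 p - [:- ((- s) ^ p):]) * H'"
        unfolding Y_def by (simp only: linear_power_char[OF p])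
      have "degree H' \<le> degree (Y ^ (e + k - p)) + (degree (of_nat (e choose k) :: 'a poly) + (degree (C ^ (e - k)) + degree H))"
        unfolding H'_def by (meson add_mono degree_mult_le order.refl order_trans)
      also have "degree (of_nat (e choose k) :: 'a poly) = 0" by simp
      also have "degree (C ^ (e - k)) = 0" by (simp add: C_def poly_const_pow)
      also have "degree (Y ^ (e + k - p)) \<le> e + k - p"
        using degree_power_le[of Y "e + k - p"] by (simp add: Y_def)
      finally have "degree H' \<le> e + k - p + degree H" by simp
      \<comment> \<open>After division by X^p - s^p the degree lies below the index dp - 1 at which
        the telescoping sum ends.\<close>
      also have "\<dots> < d * p - 1" using deg ek k by simp
      finally have "coeff H' (d * p - 1) = 0" by (simp add: coeff_eq_0)
      then have "L ?T = 0"
        unfolding T L_def by (rule telescoping_row_sum[OF p0 d])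
      then show ?thesis by simp
    qed
  qed
  finally show ?thesis unfolding Y_def L_def .
qed

text \<open>Row 0 has weight w^0 = 1, so replacing it by the combination is multiplication by a
  unitriangular matrix; the expansion along this row then shows the divisibility.\<close>

lemma dvd_det_if_dvd_row_combination:
  fixes A :: "'a::comm_ring_1 mat"
  assumes A: "A \<in> carrier_mat d d" and d: "d > 0"
    and dvd: "\<And>j. j < d \<Longrightarrow> c dvd (\<Sum>k<d. w ^ k * A $$ (k, j))"
  shows "c dvd det A"
proof -
  define U where "U = mat d d (\<lambda>(i,k). if i = 0 then w ^ k else if i = k then 1 else 0)"
  have U: "U \<in> carrier_mat d d" by (simp add: U_def)
  have "det U = prod_list (diag_mat U)"
    by (rule det_upper_triangular[OF _ U]) (auto simp: U_def upper_triangular_def)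
  also have "diag_mat U = map (\<lambda>i. 1) [0..<d]"
    by (auto simp: diag_mat_def U_def)
  also have "prod_list \<dots> = 1"
    by (induction d) simp_all
  finally have "det A = det (U * A)"
    using det_mult[OF U A] by simp
  also have "c dvd det (U * A)"
  proof -
    have UA: "U * A \<in> carrier_mat d d" using U A by simp
    have "c dvd (U * A) $$ (0, j)" if "j < d" for j
    proof -
      have "(U * A) $$ (0, j) = (\<Sum>k<d. w ^ k * A $$ (k, j))"
        using that d A by (simp add: U_def scalar_prod_def atLeast0LessThan)
      then show ?thesis using dvd[OF that] by simp
    qed
    then show ?thesis
      unfolding laplace_expansion_row[OF UA d] by (intro dvd_sum dvd_mult2) simp
  qed
  finally show ?thesis .
qed

lemma rpoly_split2:
  assumes "i < r" "j < r" "i \<noteq> j"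
  obtains H where "rpoly a r = [:- a i, 1:] * [:- a j, 1:] * H" "degree H \<le> r - 2"
proof -
  define H where "H = (\<Prod>k\<in>{..<r} - {i, j}. [:- a k, 1:])"
  have "rpoly a r = [:- a i, 1:] * (\<Prod>k\<in>{..<r} - {i}. [:- a k, 1:])"
    unfolding rpoly_def using assms by (subst prod.remove[of _ i]) auto
  also have "(\<Prod>k\<in>{..<r} - {i}. [:- a k, 1:]) = [:- a j, 1:] * H"
  proof -
    have "{..<r} - {i, j} = {..<r} - {i} - {j}" by auto
    then show ?thesis
      unfolding H_def using assms by (simp only:) (rule prod.remove, auto)
  qed
  finally have "rpoly a r = [:- a i, 1:] * [:- a j, 1:] * H" by (simp only: mult.assoc)
  moreover have "degree H \<le> sum (degree \<circ> (\<lambda>k. [:- a k, 1:])) ({..<r} - {i, j})"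
    unfolding H_def by (rule degree_prod_sum_le) simp
  then have "degree H \<le> r - 2"
    using assms by (simp add: card_Diff_subset)
  ultimately show ?thesis by (rule that)
qed

text \<open>The weights depend only on a_i, so one row combination serves all columns: each column
  polynomial is X^m f^e with m < d and contains ((X-a_i)(X-a_j))^e.\<close>

lemma power_diff_dvd_Mdet:
  fixes a :: "nat \<Rightarrow> 'a::comm_ring_1"
  assumes p: "CHAR('a) = p" "prime p" and d: "d > 0"
    and ij: "i < r" "j < r" "i \<noteq> j"
    and deg: "r * e + d < Suc d * p" and g: "g + p \<le> 2 * e + 1"
  shows "(a i - a j) ^ g dvd Mdet p r e d a"
  unfolding Mdet_def
proof (rule dvd_det_if_dvd_row_combination[OF Mmat_carrier d, where w = "- ((- a i) ^ p)"])
  fix l assume l: "l < d"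
  obtain H where H: "rpoly a r = [:- a i, 1:] * [:- a j, 1:] * H" and dH: "degree H \<le> r - 2"
    using rpoly_split2[OF ij] .
  define H' where "H' = monom 1 (d - 1 - l) * H ^ e"
  have eq: "monom 1 (d - 1 - l) * rpoly a r ^ e = ([:- a i, 1:] * [:- a j, 1:]) ^ e * H'"
    by (simp only: H H'_def power_mult_distrib mult_ac)
  have "degree H' \<le> degree (monom (1::'a) (d - 1 - l)) + degree (H ^ e)"
    unfolding H'_def by (rule degree_mult_le)
  also have "\<dots> \<le> (d - 1) + (r - 2) * e"
  proof (rule add_mono)
    show "degree (monom (1::'a) (d - 1 - l)) \<le> d - 1"
      using degree_monom_le[of "1::'a" "d - 1 - l"] by simp
    show "degree (H ^ e) \<le> (r - 2) * e"
      using degree_power_le[of H e] dH by (meson mult_le_mono1 order_trans)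
  qed
  finally have "2 * e + degree H' \<le> (d - 1) + r * e"
  proof -
    have "2 * e + (r - 2) * e = r * e"
    proof -
      obtain q where "r = q + 2" using ij that[of "r - 2"] by simp
      then show ?thesis by (simp add: algebra_simps)
    qed
    then show "degree H' \<le> (d - 1) + (r - 2) * e \<Longrightarrow> 2 * e + degree H' \<le> (d - 1) + r * e" by simp
  qed
  then have *: "2 * e + degree H' < Suc d * p - 1" using deg d by simp
  have "(a i - a j) ^ g dvd (\<Sum>k<d. (- ((- a i) ^ p)) ^ k *
      coeff (([:- a i, 1:] * [:- a j, 1:]) ^ e * H') (Suc k * p - 1))"
    by (rule dvd_row_combination[OF p d * g])
  then show "(a i - a j) ^ g dvd (\<Sum>k<d. (- ((- a i) ^ p)) ^ k * Mmat p d (rpoly a r ^ e) $$ (k, l))"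
    unfolding eq[symmetric] using l p(2) by (simp add: Mmat_index_monom prime_gt_0_nat)
qed

section \<open>From the single differences to a power of delta\<close>

lemma mvar_diff_dvd_iff:
  fixes P :: "'a::comm_ring_1 mpoly"
  shows "(mvar i - mvar j) dvd P \<longleftrightarrow> insertion mconst (mvar(j := mvar i)) P = 0"
proof
  let ?v = "mvar(j := mvar i) :: nat \<Rightarrow> 'a mpoly"
  interpret s: comm_ring_hom "insertion mconst ?v" by (rule insertion_hom[OF mconst_hom])
  show "insertion mconst ?v P = 0" if "(mvar i - mvar j) dvd P"
    using that by (auto simp: dvd_def s.hom_mult s.hom_minus insertion_mvar[OF mconst_hom])
  show "(mvar i - mvar j) dvd P" if "insertion mconst ?v P = 0"
  proof -
    \<comment> \<open>Replacing x_j by x_i changes nothing modulo x_i - x_j, and evaluation at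
      \<open>mvar\<close> is the identity.\<close>
    have "(mvar i - mvar j) dvd insertion mconst ?v P - insertion mconst mvar P"
      by (rule insertion_dvd_diff[OF mconst_hom]) simp
    then show ?thesis by (simp add: that insertion_mconst_mvar)
  qed
qed

text \<open>The difference x_i - x_j is prime, being a generator of the kernel of a homomorphism
  into a domain; its factors are cancelled one at a time.\<close>

lemma mvar_diff_power_dvd_mult:
  fixes A :: "'a::idom mpoly"
  assumes "i \<noteq> j" "(mvar i - mvar j) ^ g dvd A * B" "\<not> (mvar i - mvar j) dvd A"
  shows "(mvar i - mvar j) ^ g dvd B"
  using assms(2)
proof (induction g arbitrary: B)
  case (Suc g)
  let ?q = "mvar i - mvar j :: 'a mpoly"
  interpret s: comm_ring_hom "insertion mconst (mvar(j := mvar i)) :: 'a mpoly \<Rightarrow> 'a mpoly"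
    by (rule insertion_hom[OF mconst_hom])
  have q0: "?q \<noteq> 0" using assms(1) by simp
  have "?q dvd A * B" using Suc.prems by (metis dvd_mult_left power_Suc)
  then have "?q dvd B"
    using assms(3) by (simp add: mvar_diff_dvd_iff s.hom_mult)
  then obtain C where C: "B = ?q * C" by (elim dvdE)
  have "?q * ?q ^ g dvd ?q * (A * C)"
    using Suc.prems by (simp add: C mult_ac)
  then have "?q ^ g dvd A * C"
    using q0 by (metis dvd_mult_cancel_left)
  then have "?q ^ g dvd C" by (rule Suc.IH)
  then show ?case by (simp add: C mult_dvd_mono)
qed simp

text \<open>Identifying x_j with x_i kills no other difference in the product, so the new prime
  divides none of the earlier factors. Requiring i < j keeps out the reversed pair.\<close>

lemma prod_mvar_diff_power_dvd:
  fixes D :: "'a::idom mpoly"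
  assumes "finite S" "\<And>i j. (i, j) \<in> S \<Longrightarrow> i < j \<and> (mvar i - mvar j) ^ g dvd D"
  shows "(\<Prod>(i,j)\<in>S. (mvar i - mvar j) ^ g) dvd D"
  using assms
proof (induction S)
  case (insert x S)
  obtain i j where x: "x = (i, j)" by (cases x)
  let ?A = "\<Prod>(i,j)\<in>S. (mvar i - mvar j) ^ g :: 'a mpoly"
  have ij: "i < j" "(mvar i - mvar j) ^ g dvd D" using insert.prems[of i j] x by auto
  have "?A dvd D" using insert by auto
  then obtain B where B: "D = ?A * B" by (elim dvdE)
  interpret s: comm_ring_hom "insertion mconst (mvar(j := mvar i)) :: 'a mpoly \<Rightarrow> 'a mpoly"
    by (rule insertion_hom[OF mconst_hom])
  have "insertion mconst (mvar(j := mvar i)) ?A \<noteq> 0"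
  proof -
    have "(if k = j then mvar i else mvar k) \<noteq> (if l = j then mvar i else mvar l :: 'a mpoly)"
      if "(k, l) \<in> S" for k l
    proof -
      have "k < l" "(k, l) \<noteq> (i, j)"
        using insert.prems[of k l] insert.hyps x that by auto
      then show ?thesis using ij(1) by auto
    qed
    then show ?thesis
      by (auto simp: s.hom_prod s.hom_power s.hom_minus insertion_mvar[OF mconst_hom] case_prod_beta
          insert.hyps(1))
  qed
  then have "(mvar i - mvar j) ^ g dvd B"
    using ij by (intro mvar_diff_power_dvd_mult[of i j g ?A B]) (auto simp: mvar_diff_dvd_iff simp flip: B)
  then show ?case
    using insert.hyps x by (simp add: B mult.commute mult_dvd_mono)
qed simp

lemma delta_power_dvd:
  fixes D :: "'a::idom mpoly"
  assumes "\<And>i j. i < j \<Longrightarrow> j < r \<Longrightarrow> (mvar i - mvar j) ^ g dvd D"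
  shows "vdm mvar r ^ g dvd D"
proof -
  have "vdm mvar r ^ g = (\<Prod>(i,j)\<in>Sigma {..<r} (\<lambda>i. {i<..<r}). (mvar i - mvar j :: 'a mpoly) ^ g)"
    by (subst prod.Sigma[symmetric]) (auto simp: vdm_def prod_power_distrib)
  also have "\<dots> dvd D"
    by (rule prod_mvar_diff_power_dvd) (use assms in auto)
  finally show ?thesis .
qed

section \<open>The dilation homomorphism\<close>

text \<open>Sends x_i to T x_i for a new variable T. A polynomial P is homogeneous of degree n
  exactly when its image is T^n P, so no degree function on \<open>mpoly\<close> is
  required.\<close>

definition dilate :: "'a::comm_ring_1 mpoly \<Rightarrow> 'a mpoly poly" where
  "dilate = insertion (\<lambda>c. [:mconst c:]) (\<lambda>i. [:0, 1:] * [:mvar i:])"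

lemma const_poly_hom: "comm_ring_hom (\<lambda>c. [:c:])"
  by unfold_locales (simp_all add: one_pCons)

lemma mconst_poly_hom: "comm_ring_hom (\<lambda>c. [:mconst c:])"
proof -
  interpret m: comm_ring_hom "mconst :: 'a \<Rightarrow> 'a mpoly" by (rule mconst_hom)
  show ?thesis by unfold_locales (simp_all add: m.hom_add m.hom_mult one_pCons)
qed

lemma dilate_hom: "comm_ring_hom dilate"
  unfolding dilate_def by (rule insertion_hom[OF mconst_poly_hom])

lemma dilate_mvar: "dilate (mvar i) = [:0, 1:] * [:mvar i:]"
  and dilate_mconst: "dilate (mconst c) = [:mconst c:]"
  by (simp_all add: dilate_def insertion_mvar[OF mconst_poly_hom] insertion_mconst[OF mconst_poly_hom])

text \<open>The hypothesis says that Q is homogeneous of degree 0. Setting T = 0 in its dilation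
  evaluates Q at the origin.\<close>

lemma mconst_if_dilate_eq:
  assumes "dilate Q = [:Q:]"
  obtains c where "Q = mconst c"
proof -
  have "Q = poly (dilate Q) 0" by (simp add: assms)
  also have "\<dots> = insertion mconst (\<lambda>_. 0) Q"
    unfolding dilate_def
    by (subst hom_insertion[OF mconst_poly_hom poly_hom.comm_ring_hom_axioms]) (simp add: o_def)
  also have "\<dots> = mconst (Poly_Mapping.lookup Q 0)" by (rule insertion_mconst_zero)
  finally show ?thesis by (rule that)
qed

lemma dilate_vdm: "dilate (vdm mvar r) = [:0, 1:] ^ wt_vdm r * [:vdm mvar r:]"
  by (simp only: hom_vdm[OF dilate_hom] hom_vdm[OF const_poly_hom] dilate_mvar vdm_scale)

lemma dilate_Mdet:
  "[:0, 1:] ^ wt_row p d * dilate (Mdet p r e d mvar) = [:0, 1:] ^ (r * e * d + wt_col d) * [:Mdet p r e d mvar:]"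
  by (simp only: hom_Mdet[OF dilate_hom] hom_Mdet[OF const_poly_hom] dilate_mvar Mdet_scale)

text \<open>Both sides of \<open>eq\<close> are nonzero and homogeneous; the conclusion compares
  their degrees, doubled to clear the halves and rearranged to avoid subtraction.\<close>

lemma degree_identity:
  fixes c :: "'a::idom"
  assumes eq: "Mdet p r e d mvar = mconst c * vdm mvar r ^ g" and c: "c \<noteq> 0"
  shows "p * d * (d + 1) + g * (r * (r - 1)) = 2 * r * e * d + d * (d + 1)"
proof -
  let ?D = "Mdet p r e d (mvar :: nat \<Rightarrow> 'a mpoly)" and ?T = "[:0, 1:] :: 'a mpoly poly"
  interpret h: comm_ring_hom "dilate :: 'a mpoly \<Rightarrow> 'a mpoly poly" by (rule dilate_hom)
  interpret c: comm_ring_hom "\<lambda>c :: 'a mpoly. [:c:]" by (rule const_poly_hom)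
  have "mconst c \<noteq> 0" using c by (metis lookup_single_eq lookup_zero mconst_def)
  moreover have "vdm mvar r \<noteq> (0 :: 'a mpoly)" by (simp add: vdm_eq_0_iff inj_on_def)
  ultimately have D0: "?D \<noteq> 0" by (simp add: eq)
  have dil: "dilate ?D = ?T ^ (g * wt_vdm r) * [:?D:]"
    by (simp only: eq h.hom_mult h.hom_power dilate_mconst dilate_vdm c.hom_mult c.hom_power
        power_mult_distrib power_mult[symmetric] mult_ac)
  have "?T ^ (wt_row p d + g * wt_vdm r) * [:?D:] = ?T ^ (r * e * d + wt_col d) * [:?D:]"
    using dilate_Mdet[of p d r e, where 'a='a] unfolding dil by (simp only: power_add mult.assoc)
  then have "?T ^ (wt_row p d + g * wt_vdm r) = ?T ^ (r * e * d + wt_col d)"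
  proof -
    assume "?T ^ (wt_row p d + g * wt_vdm r) * [:?D:] = ?T ^ (r * e * d + wt_col d) * [:?D:]"
    moreover have "[:?D:] \<noteq> 0" using D0 by (simp only: pCons_eq_0_iff simp_thms)
    ultimately show ?thesis by (simp only: mult_cancel_right simp_thms)
  qed
  then have "degree (?T ^ (wt_row p d + g * wt_vdm r)) = degree (?T ^ (r * e * d + wt_col d))"
    by simp
  then have "wt_row p d + g * wt_vdm r = r * e * d + wt_col d"
    by (simp add: degree_power_eq)
  then have "2 * wt_row p d + g * (2 * wt_vdm r) = 2 * r * e * d + 2 * wt_col d" by simp
  then show ?thesis by (simp only: wt_row wt_col wt_vdm)
qed

text \<open>Here delta^g divides the determinant, and \<open>hom\<close> says that both have the
  same degree, so the quotient is homogeneous of degree 0. It may still be zero at this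
  point.\<close>

lemma Mdet_eq_const_delta_power:
  fixes p :: nat
  assumes p: "CHAR('a::idom) = p" "prime p" and d: "d > 0"
    and deg: "r * e + d < Suc d * p" and g: "g + p \<le> 2 * e + 1"
    and hom: "p * d * (d + 1) + g * (r * (r - 1)) = 2 * r * e * d + d * (d + 1)"
  obtains c :: "'a::idom" where "Mdet p r e d mvar = mconst c * vdm mvar r ^ g"
proof -
  let ?D = "Mdet p r e d (mvar :: nat \<Rightarrow> 'a mpoly)" and ?V = "vdm mvar r :: 'a mpoly"
    and ?T = "[:0, 1:] :: 'a mpoly poly"
  interpret h: comm_ring_hom "dilate :: 'a mpoly \<Rightarrow> 'a mpoly poly" by (rule dilate_hom)
  interpret c: comm_ring_hom "\<lambda>c :: 'a mpoly. [:c:]" by (rule const_poly_hom)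
  have "?V ^ g dvd ?D"
    by (rule delta_power_dvd, rule power_diff_dvd_Mdet) (use p d deg g in auto)
  then obtain Q where Q: "?D = ?V ^ g * Q" by (elim dvdE)
  have V0: "?V \<noteq> 0" by (simp add: vdm_eq_0_iff inj_on_def)
  have "2 * wt_row p d + g * (2 * wt_vdm r) = 2 * (r * e * d) + 2 * wt_col d"
    unfolding wt_row wt_col wt_vdm using hom by simp
  then have w: "wt_row p d + g * wt_vdm r = r * e * d + wt_col d" by simp
  have "?T ^ wt_row p d * (?T ^ (g * wt_vdm r) * [:?V:] ^ g * dilate Q) =
      ?T ^ (r * e * d + wt_col d) * ([:?V:] ^ g * [:Q:])"
    using dilate_Mdet[of p d r e, where 'a='a] unfolding Q
    by (simp only: h.hom_mult h.hom_power dilate_vdm c.hom_mult c.hom_power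
        power_mult_distrib power_mult[symmetric] mult_ac)
  then have "?T ^ (wt_row p d + g * wt_vdm r) * [:?V:] ^ g * dilate Q =
      ?T ^ (r * e * d + wt_col d) * [:?V:] ^ g * [:Q:]"
    by (simp only: power_add mult_ac)
  then have "dilate Q = [:Q:]"
  proof -
    have "?T ^ (r * e * d + wt_col d) * [:?V:] ^ g \<noteq> 0" using V0 by simp
    moreover assume "?T ^ (wt_row p d + g * wt_vdm r) * [:?V:] ^ g * dilate Q =
        ?T ^ (r * e * d + wt_col d) * [:?V:] ^ g * [:Q:]"
    ultimately show ?thesis unfolding w by (simp only: mult_cancel_left simp_thms)
  qed
  then obtain c where "Q = mconst c" by (rule mconst_if_dilate_eq)
  then show ?thesis using that[of c] Q by (simp only: mult.commute)
qed

section \<open>Specialisation to binomials\<close>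

lemma det_zero_row:
  assumes A: "A \<in> carrier_mat n n" and i: "i < n" and z: "\<And>j. j < n \<Longrightarrow> A $$ (i, j) = 0"
  shows "det A = 0"
  unfolding laplace_expansion_row[OF A i] using z by simp

text \<open>The nonzero entries form the graph of one permutation, so the Leibniz sum has a single
  nonzero term.\<close>

lemma det_nonzero_if_permutation_pattern:
  fixes A :: "'a::idom mat"
  assumes A: "A \<in> carrier_mat n n"
    and ex: "\<And>i. i < n \<Longrightarrow> \<exists>j<n. A $$ (i, j) \<noteq> 0"
    and row: "\<And>i j j'. i < n \<Longrightarrow> j < n \<Longrightarrow> j' < n \<Longrightarrow> A $$ (i, j) \<noteq> 0 \<Longrightarrow> A $$ (i, j') \<noteq> 0 \<Longrightarrow> j = j'"
    and col: "\<And>i i' j. i < n \<Longrightarrow> i' < n \<Longrightarrow> j < n \<Longrightarrow> A $$ (i, j) \<noteq> 0 \<Longrightarrow> A $$ (i', j) \<noteq> 0 \<Longrightarrow> i = i'"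
  shows "det A \<noteq> 0"
proof -
  obtain f where f: "\<And>i. i < n \<Longrightarrow> f i < n \<and> A $$ (i, f i) \<noteq> 0"
    using ex by metis
  define q where "q i = (if i < n then f i else i)" for i
  have "inj_on q {0..<n}"
  proof (rule inj_onI)
    fix x y assume "x \<in> {0..<n}" "y \<in> {0..<n}" "q x = q y"
    then have "x < n" "y < n" "f x = f y" by (auto simp: q_def)
    then show "x = y" using f[of x] f[of y] col[of x y "f x"] by simp
  qed
  moreover have "q ` {0..<n} \<subseteq> {0..<n}" using f by (auto simp: q_def)
  ultimately have "bij_betw q {0..<n} {0..<n}"
    by (simp add: bij_betw_def endo_inj_surj)
  then have q: "q permutes {0..<n}"
    by (rule bij_imp_permutes) (simp add: q_def)
  have other: "(\<Prod>i = 0..<n. A $$ (i, p i)) = 0" if p: "p permutes {0..<n}" "p \<noteq> q" for p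
  proof -
    obtain i where i: "p i \<noteq> q i" using p(2) by blast
    then have "i < n" using p(1) q by (metis atLeastLessThan_iff permutes_not_in zero_le)
    moreover from this have "p i < n" using p(1) by (metis atLeastLessThan_iff permutes_in_image zero_le)
    ultimately have "A $$ (i, p i) = 0" using i f[of i] row[of i "p i" "f i"] by (auto simp: q_def)
    with \<open>i < n\<close> show ?thesis by (intro prod_zero) auto
  qed
  have "det A = (\<Sum>p | p permutes {0..<n}. signof p * (\<Prod>i = 0..<n. A $$ (i, p i)))"
    by (rule det_def'[OF A])
  also have "\<dots> = (\<Sum>p | p permutes {0..<n}. if p = q then signof q * (\<Prod>i = 0..<n. A $$ (i, q i)) else 0)"
  proof (rule sum.cong)
    fix p assume "p \<in> {p. p permutes {0..<n}}"
    then have "p \<noteq> q \<Longrightarrow> (\<Prod>i = 0..<n. A $$ (i, p i)) = 0" using other by blast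
    then show "signof p * (\<Prod>i = 0..<n. A $$ (i, p i)) =
        (if p = q then signof q * (\<Prod>i = 0..<n. A $$ (i, q i)) else 0)"
      by (cases "p = q") (simp_all only: if_True if_False mult_zero_right simp_thms)
  qed simp
  also have "\<dots> = signof q * (\<Prod>i = 0..<n. A $$ (i, q i))"
    using q by (simp add: finite_permutations)
  also have "\<dots> \<noteq> 0"
    using f by (auto simp: q_def sign_def)
  finally show ?thesis .
qed

lemma binomial_power_expansion:
  "(monom 1 u * (monom 1 s - 1)) ^ e =
   (\<Sum>k\<le>e. monom (of_nat (e choose k) * (- 1) ^ (e - k) :: 'a::comm_ring_1) (u * e + s * k))"
proof -
  have "(monom (1::'a) s + (- 1)) ^ e = (\<Sum>k\<le>e. of_nat (e choose k) * monom 1 s ^ k * (- 1) ^ (e - k))"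
    by (rule binomial_ring)
  also have "\<dots> = (\<Sum>k\<le>e. monom (of_nat (e choose k) * (- 1) ^ (e - k)) (s * k))"
  proof (rule sum.cong)
    fix k
    have "(- 1 :: 'a poly) = [:- 1:]" by (simp add: one_pCons)
    then have "of_nat (e choose k) * monom 1 s ^ k * (- 1) ^ (e - k) =
        [:of_nat (e choose k):] * monom 1 (s * k) * [:(- 1) ^ (e - k) :: 'a:]"
      by (simp only: poly_const_pow of_nat_poly monom_power power_one)
    then show "of_nat (e choose k) * monom 1 s ^ k * (- 1) ^ (e - k) =
        monom (of_nat (e choose k) * (- 1) ^ (e - k) :: 'a) (s * k)"
      by (simp add: smult_monom mult.commute)
  qed simp
  finally show ?thesis
    by (simp add: power_mult_distrib monom_power sum_distrib_left mult_monom)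
qed

lemma binomial_coeff_nonzero:
  assumes p: "CHAR('a::idom) = p" "prime p" and e: "e < p" "k \<le> e"
  shows "of_nat (e choose k) \<noteq> (0 :: 'a)"
proof -
  have "\<not> p dvd fact e" using p e by (simp add: prime_dvd_fact_iff)
  moreover have "(e choose k) dvd fact e"
    by (metis binomial_fact_lemma dvd_triv_right e(2))
  ultimately show ?thesis
    using p(1) by (metis dvd_trans of_nat_eq_0_iff_char_dvd)
qed

text \<open>For s > 0 the exponents ue + sk are pairwise distinct, so nothing cancels, and e < p
  keeps the binomial coefficients nonzero.\<close>

lemma icoeff_binomial_power:
  assumes p: "CHAR('a::idom) = p" "prime p" and e: "e < p" and s: "s > 0"
  shows "icoeff ((monom 1 u * (monom 1 s - 1)) ^ e :: 'a poly) z \<noteq> 0 \<longleftrightarrow> (\<exists>k\<le>e. z = int (u * e + s * k))"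
proof -
  let ?c = "\<lambda>k. of_nat (e choose k) * (- 1) ^ (e - k) :: 'a"
  have c: "coeff ((monom 1 u * (monom 1 s - 1)) ^ e) n =
      (\<Sum>k\<le>e. if u * e + s * k = n then ?c k else 0)" for n
    by (simp add: binomial_power_expansion coeff_sum)
  have *: "coeff ((monom 1 u * (monom 1 s - 1)) ^ e :: 'a poly) n \<noteq> 0 \<longleftrightarrow> (\<exists>k\<le>e. n = u * e + s * k)" for n
  proof
    assume "coeff ((monom 1 u * (monom 1 s - 1)) ^ e :: 'a poly) n \<noteq> 0"
    then show "\<exists>k\<le>e. n = u * e + s * k"
      unfolding c by (rule contrapos_np) (auto intro!: sum.neutral)
  next
    assume "\<exists>k\<le>e. n = u * e + s * k"
    then obtain k where k: "k \<le> e" "n = u * e + s * k" by blast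
    have "coeff ((monom 1 u * (monom 1 s - 1)) ^ e :: 'a poly) n = (\<Sum>l\<le>e. if l = k then ?c l else 0)"
      unfolding c by (rule sum.cong) (use s k in auto)
    also have "\<dots> = ?c k" using k by simp
    finally show "coeff ((monom 1 u * (monom 1 s - 1)) ^ e :: 'a poly) n \<noteq> 0"
      using binomial_coeff_nonzero[OF p e k(1)] by simp
  qed
  show ?thesis
  proof (cases "z < 0")
    case True
    then have "z \<noteq> int n" for n by simp
    with True show ?thesis by (simp add: icoeff_def del: of_nat_add of_nat_mult)
  next
    case False
    then have "z = int (nat z)" by simp
    then show ?thesis using False *[of "nat z"]
      by (metis icoeff_def of_nat_eq_iff)
  qed
qed

text \<open>A repeated root x would also be a root of the derivative. For u = 0 the latter is s
  X^(s-1), which forces x = 0, not a root. For u = 1 it follows that x is nonzero and x^s = 1, and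
  the derivative takes the value s there, which is nonzero.\<close>

lemma binomial_splits:
  assumes p: "CHAR('a::alg_closed_field) = p" and s: "s > 0" "\<not> p dvd s" and u: "u \<le> 1"
  obtains a :: "nat \<Rightarrow> 'a::alg_closed_field" where "inj_on a {..<s + u}" "rpoly a (s + u) = monom 1 u * (monom 1 s - 1)"
proof -
  define q :: "'a poly" where "q = monom 1 u * (monom 1 s - 1)"
  have q: "q = monom 1 (s + u) - monom 1 u"
    by (simp add: q_def algebra_simps mult_monom)
  have s0: "of_nat s \<noteq> (0 :: 'a)" using p s by (simp add: of_nat_eq_0_iff_char_dvd)
  have lc: "coeff q (s + u) = 1" using s by (simp add: q coeff_monom)
  have "degree q = s + u"
  proof (rule antisym)
    show "degree q \<le> s + u"
      unfolding q by (rule degree_diff_le) (simp_all add: degree_monom_eq)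
    show "s + u \<le> degree q" using lc by (intro le_degree) simp
  qed
  moreover from this have "q \<noteq> 0" using s by auto
  ultimately obtain A where A: "size A = s + u" "q = (\<Prod>x\<in>#A. [:- x, 1:])"
    using alg_closed_imp_factorization[of q] lc by auto
  obtain xs where xs: "mset xs = A" by (metis ex_mset)
  have len: "length xs = s + u" using A(1) xs by auto
  have "q = prod_list (map (\<lambda>x. [:- x, 1:]) xs)"
    unfolding A(2) by (simp flip: xs prod_mset_prod_list)
  also have "\<dots> = rpoly ((!) xs) (s + u)"
    unfolding rpoly_def by (subst prod.list_conv_set_nth) (simp add: len atLeast0LessThan)
  finally have R: "rpoly ((!) xs) (s + u) = q" by simp
  have "inj_on ((!) xs) {..<s + u}"
  proof (rule inj_onI, rule ccontr)
    fix i j assume ij: "i \<in> {..<s + u}" "j \<in> {..<s + u}" "xs ! i = xs ! j" "i \<noteq> j"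
    define x where "x = xs ! i"
    obtain H where H: "rpoly ((!) xs) (s + u) = [:- xs ! i, 1:] * [:- xs ! j, 1:] * H"
      using rpoly_split2[of i "s + u" j "(!) xs"] ij by (metis lessThan_iff)
    define L where "L = [:- x, 1:]"
    have "poly L x = 0" by (simp add: L_def)
    moreover have "q = L * L * H"
      unfolding R[symmetric] H ij(3)[symmetric] x_def[symmetric] L_def ..
    ultimately have "poly q x = 0" "poly (pderiv q) x = 0"
      by (simp_all add: pderiv_mult)
    then have x: "x ^ (s + u) = x ^ u" "of_nat (s + u) * x ^ (s + u - 1) = of_nat u * x ^ (u - 1)"
      by (simp_all add: q pderiv_diff pderiv_monom poly_monom)
    from u consider "u = 0" | "u = 1" by linarith
    then show False
    proof cases
      case 1
      then have "x ^ s = 1" "x ^ (s - 1) = 0" using x s0 by auto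
      then show False using s by (cases s) auto
    next
      case 2
      then have x': "x * x ^ s = x" "(of_nat s + 1) * x ^ s = 1" using x by (simp_all add: add.commute)
      then have "x \<noteq> 0" using s(1) by (auto simp: zero_power)
      with x' have "x ^ s = 1" by simp
      with x' s0 show False by simp
    qed
  qed
  with R show ?thesis using that q_def by blast
qed

lemma Mmat_binomial_entry:
  fixes a :: "nat \<Rightarrow> 'a::idom"
  assumes p: "CHAR('a) = p" "prime p" and e: "e < p" and s: "s > 0"
    and a: "rpoly a (s + u) = monom 1 u * (monom 1 s - 1)" and ij: "i < d" "j < d"
  shows "Mmat p d (rpoly a (s + u) ^ e) $$ (i, j) \<noteq> 0 \<longleftrightarrow> (\<exists>k\<le>e. Suc i * p + j = d + u * e + s * k)"
proof -
  have "(int (Suc i * p + j) - int d = int (u * e + s * k)) \<longleftrightarrow> Suc i * p + j = d + u * e + s * k" for k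
    by linarith
  then show ?thesis
    unfolding a Mmat_index[OF ij] icoeff_binomial_power[OF p e s] by simp
qed

lemma eq_if_dvd_diff_lt:
  assumes "int s dvd int i - int j" "i < s" "j < s"
  shows "i = j"
  using assms by (metis int_ops(9) mod_eq_dvd_iff mod_less of_nat_eq_iff)

text \<open>A nonzero entry fixes (i+1)p + j modulo s. Since d \<le> s, the row determines the
  column; since p is invertible modulo s, the column determines the row.\<close>

lemma Mdet_binomial_nonzero:
  fixes a :: "nat \<Rightarrow> 'a::idom"
  assumes p: "CHAR('a) = p" "prime p" and e: "e < p" and s: "s > 0" "\<not> p dvd s"
    and a: "rpoly a (s + u) = monom 1 u * (monom 1 s - 1)"
    and ud: "u = 0 \<and> d + 1 = s \<or> u = 1 \<and> d = s"
    and le: "d * p \<le> (s + u) * e + d"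
  shows "Mdet p (s + u) e d a \<noteq> 0"
  unfolding Mdet_def
proof (rule det_nonzero_if_permutation_pattern[OF Mmat_carrier])
  note entry = Mmat_binomial_entry[OF p e s(1) a]
  have cop: "coprime (int p) (int s)"
    using p(2) s(2) by (simp add: prime_imp_coprime)
  have ds: "d \<le> s" using ud by auto
  fix i assume i: "i < d"
  show "\<exists>j<d. Mmat p d (rpoly a (s + u) ^ e) $$ (i, j) \<noteq> 0"
  proof -
    \<comment> \<open>The equation for column j = d - 1 - l reads m = sk + l, so k and l come from
      division with remainder by s.\<close>
    define m where "m = Suc i * p - u * e - 1"
    have "u * e < p" using ud e by auto
    then have m: "Suc i * p = m + u * e + 1" unfolding m_def by simp
    define k where "k = m div s"
    define l where "l = m mod s"
    have ml: "m = s * k + l" "l < s" using s by (simp_all add: k_def l_def)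
    have "l < d"
    proof (rule ccontr)
      \<comment> \<open>Only the residue s - 1 can be missed, and only for u = 0; it would make s
        divide (i+1)p and hence i + 1, although i + 1 \<le> d < s.\<close>
      assume "\<not> l < d"
      with ud ml have u0: "u = 0" and "l + 1 = s" by auto
      then have "Suc i * p = s * (k + 1)" using m ml by simp
      then have "int s dvd int (Suc i) * int p" by (metis dvd_triv_left of_nat_mult)
      then have "int s dvd int (Suc i)"
        using cop by (metis coprime_commute coprime_dvd_mult_left_iff)
      then have "s \<le> Suc i" by (metis dvd_imp_le of_nat_dvd_iff zero_less_Suc)
      then show False using i ud u0 by auto
    qed
    have "Suc i * p \<le> d * p" using i by (intro mult_right_mono) auto
    \<comment> \<open>By \<open>le\<close>, m is at most se + d - 1, which is below s(e+1).\<close>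
    then have "s * k < s * (e + 1)"
      using m ml le ds by (simp add: algebra_simps)
    then have "k < e + 1" by (simp only: mult_less_cancel1)
    then have "k \<le> e" by simp
    moreover have "Suc i * p + (d - 1 - l) = d + u * e + s * k"
      using m ml \<open>l < d\<close> by simp
    ultimately show ?thesis
      using entry[OF i, of "d - 1 - l"] \<open>l < d\<close> by (intro exI[of _ "d - 1 - l"]) auto
  qed
  fix j assume j: "j < d"
  show "j = j'" if j': "j' < d" and nz: "Mmat p d (rpoly a (s + u) ^ e) $$ (i, j) \<noteq> 0"
      "Mmat p d (rpoly a (s + u) ^ e) $$ (i, j') \<noteq> 0" for j'
  proof -
    obtain k k' where "Suc i * p + j = d + u * e + s * k" "Suc i * p + j' = d + u * e + s * k'"
      using nz entry[OF i j] entry[OF i j'] by auto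
    then have "int j - int j' = int s * (int k - int k')"
      by (simp add: right_diff_distrib flip: of_nat_mult)
    then show ?thesis
      using j j' ds by (intro eq_if_dvd_diff_lt[of s]) auto
  qed
  show "i = i'" if i': "i' < d" and nz: "Mmat p d (rpoly a (s + u) ^ e) $$ (i, j) \<noteq> 0"
      "Mmat p d (rpoly a (s + u) ^ e) $$ (i', j) \<noteq> 0" for i'
  proof -
    obtain k k' where "Suc i * p + j = d + u * e + s * k" "Suc i' * p + j = d + u * e + s * k'"
      using nz entry[OF i j] entry[OF i' j] by auto
    then have "int (Suc i * p) - int (Suc i' * p) = int (s * k) - int (s * k')"
      by linarith
    then have "(int i - int i') * int p = int s * (int k - int k')"
      by (simp add: algebra_simps)
    then have "int s dvd int i - int i'"
      using cop by (metis coprime_commute coprime_dvd_mult_left_iff dvd_triv_left)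
    then show ?thesis
      using i i' ds by (intro eq_if_dvd_diff_lt[of s]) auto
  qed
qed

text \<open>Let a = p mod r, so a \<ge> 2, and suppose d < r - 1. Multiplication by p permutes
  {1..d}. The residue r - a = -a is not hit, since ip = -a would force r to divide i + 1; hence d <
  r - a. The first multiple of a beyond d is then still below r, so it is a residue outside the
  segment.\<close>

lemma initial_segment_stable_under_mult:
  fixes p r d :: nat
  assumes cop: "coprime p r" and p1: "p \<ge> 1" "\<not> r dvd p - 1" and d: "d \<ge> 1" "d < r"
    and stable: "\<And>i. 1 \<le> i \<Longrightarrow> i \<le> d \<Longrightarrow> i * p mod r \<in> {1..d}"
  shows "d = r - 1"
proof (rule ccontr)
  assume "d \<noteq> r - 1"
  then have dr: "d + 1 < r" using d by simp
  define a where "a = p mod r"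
  have ar: "a < r" using d by (simp add: a_def)
  have a_le: "1 \<le> a" "a \<le> d" using stable[of 1] d by (auto simp: a_def)
  have "a \<noteq> 1"
  proof
    assume "a = 1"
    then have "p = r * (p div r) + 1" unfolding a_def by (metis mult_div_mod_eq)
    then have "p - 1 = r * (p div r)" by simp
    then show False using p1 by simp
  qed
  let ?f = "\<lambda>i. i * p mod r"
  have "inj_on ?f {1..d}"
  proof (rule inj_onI)
    fix i j assume ij: "i \<in> {1..d}" "j \<in> {1..d}" "?f i = ?f j"
    then have "[i * p = j * p] (mod r)" by (simp add: cong_def)
    then have "[i = j] (mod r)" using cop by (simp add: cong_mult_rcancel_nat)
    then show "i = j" using ij d by (simp add: cong_less_modulus_unique_nat)
  qed
  moreover have "?f ` {1..d} \<subseteq> {1..d}" using stable by auto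
  ultimately have surj: "?f ` {1..d} = {1..d}" by (simp add: endo_inj_surj)
  have "d < r - a"
  proof (rule ccontr)
    assume "\<not> d < r - a"
    then have "r - a \<in> ?f ` {1..d}" using ar unfolding surj by auto
    then obtain i where i: "i \<in> {1..d}" "i * p mod r = r - a" by force
    have "(i + 1) * p mod r = (i * p mod r + a) mod r"
      by (simp add: a_def mod_simps algebra_simps)
    also have "\<dots> = 0" using i ar by simp
    finally have "r dvd (i + 1) * p" by auto
    then have "r dvd i + 1" using cop by (metis coprime_commute coprime_dvd_mult_left_iff)
    then have "r \<le> i + 1" by (rule dvd_imp_le) simp
    then show False using i dr by simp
  qed
  \<comment> \<open>The first multiple of a beyond d is (k+1)a, and a \<ge> 2 ensures that k + 1
    itself lies in the segment.\<close>
  define k where "k = d div a"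
  have k: "k * a \<le> d" "d < (k + 1) * a" "k \<ge> 1"
    using a_le by (auto simp: k_def div_greater_zero_iff Suc_le_eq dividend_less_div_times)
  have "2 \<le> a" using a_le \<open>a \<noteq> 1\<close> by simp
  then have "k * 2 \<le> k * a" by simp
  then have kd: "k + 1 \<le> d" using k by linarith
  have "(k + 1) * a < r" using k(1) \<open>d < r - a\<close> by (simp add: algebra_simps)
  moreover have "(k + 1) * p mod r = (k + 1) * a mod r" by (simp only: a_def mod_mult_right_eq)
  ultimately have "(k + 1) * p mod r = (k + 1) * a" by simp
  then show False using stable[of "k + 1"] kd k(2) by simp
qed

section \<open>The classification\<close>

lemma Mdet_eval:
  fixes h :: "'a::comm_ring_1 \<Rightarrow> 'b::comm_ring_1" and a :: "nat \<Rightarrow> 'b"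
  assumes "comm_ring_hom h"
  shows "insertion h a (Mdet p r e d mvar) = Mdet p r e d a"
  by (simp add: hom_Mdet[OF insertion_hom[OF assms]] insertion_mvar[OF assms])

text \<open>The source of all necessary conditions: a vanishing determinant at a single tuple of
  distinct roots rules out the triple.\<close>

lemma Mdet_nonzero_at_distinct:
  fixes h :: "'a::comm_ring_1 \<Rightarrow> 'b::idom" and a :: "nat \<Rightarrow> 'b"
  assumes h: "comm_ring_hom h" and eq: "Mdet p r e d mvar = mconst c * vdm mvar r ^ g"
    and "h c \<noteq> 0" "inj_on a {..<r}"
  shows "Mdet p r e d a \<noteq> 0"
proof -
  interpret i: comm_ring_hom "insertion h a" by (rule insertion_hom[OF h])
  have "Mdet p r e d a = h c * vdm a r ^ g"
    unfolding Mdet_eval[OF h, symmetric] eq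
    by (simp add: i.hom_mult i.hom_power insertion_mconst[OF h] insertion_mvar[OF h] hom_vdm[OF insertion_hom[OF h]])
  then show ?thesis using assms(3,4) by (simp add: vdm_eq_0_iff)
qed

text \<open>A root 0 makes X^e divide f^e, so for e \<ge> p the first row, which reads coefficients
  at X^(p-1), vanishes.\<close>

lemma Mdet_eq_0_if_root_0:
  assumes "i < r" "a i = 0" "p \<le> e" "p > 0" "d > 0"
  shows "Mdet p r e d a = 0"
  unfolding Mdet_def
proof (rule det_zero_row[OF Mmat_carrier \<open>d > 0\<close>])
  fix j assume j: "j < d"
  have "rpoly a r = monom 1 1 * (\<Prod>k\<in>{..<r} - {i}. [:- a k, 1:])"
    unfolding rpoly_def using assms by (subst prod.remove[of _ i]) (auto simp: monom_altdef)
  then have "monom 1 (d - 1 - j) * rpoly a r ^ e =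
      monom 1 (e + (d - 1 - j)) * (\<Prod>k\<in>{..<r} - {i}. [:- a k, 1:]) ^ e"
    by (simp only: power_mult_distrib monom_power mult.assoc[symmetric] mult_monom) (simp add: add.commute)
  then show "Mmat p d (rpoly a r ^ e) $$ (0, j) = 0"
    using assms by (simp only: Mmat_index_monom[OF \<open>d > 0\<close> j \<open>p > 0\<close>]) (simp add: coeff_monom_mult)
qed

text \<open>The last row only reads coefficients of f^e of index at least dp - d, beyond the degree
  re.\<close>

lemma Mdet_eq_0_if_degree_small:
  assumes "r * e + d < d * p" "d > 0"
  shows "Mdet p r e d a = 0"
  unfolding Mdet_def
proof (rule det_zero_row[OF Mmat_carrier, of "d - 1"])
  fix j assume j: "j < d"
  have "degree (rpoly a r ^ e) < nat (int (d * p + j) - int d)"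
    using degree_rpoly_power_le[of a r e] assms by linarith
  moreover have "Suc (d - 1) = d" using assms by simp
  ultimately show "Mmat p d (rpoly a r ^ e) $$ (d - 1, j) = 0"
    using assms by (subst Mmat_index[OF _ j]) (auto simp: icoeff_def coeff_eq_0)
qed (use assms in simp)


text \<open>For e = p - 1 and d = r the last row starts at index r(p-1), the degree of f^e, so it is
  (1, 0, ..., 0).\<close>

lemma Mdet_last_row_expansion:
  fixes a :: "nat \<Rightarrow> 'a::idom"
  assumes r: "r > 0" and p: "p > 0"
  shows "Mdet p r (p - 1) r a = (- 1) ^ (r - 1) * Mdet p r (p - 1) (r - 1) a"
proof -
  let ?F = "rpoly a r ^ (p - 1)" and ?A = "Mmat p r (rpoly a r ^ (p - 1))"
  have lc: "coeff ?F (r * (p - 1)) = 1"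
    using lead_coeff_power[of "rpoly a r" "p - 1"] degree_power_eq[of "rpoly a r" "p - 1"] monic_rpoly[of a r]
    by (cases "rpoly a r = 0") (auto simp: degree_rpoly mult.commute)
  have S: "Suc (r - 1) = r" using r by simp
  have idx: "nat (int (r * p + j) - int r) = r * (p - 1) + j" "\<not> int (r * p + j) - int r < 0" for j
  proof -
    have "r * p = r * (p - 1) + r" using p by (cases p) auto
    then show "nat (int (r * p + j) - int r) = r * (p - 1) + j" "\<not> int (r * p + j) - int r < 0"
      by linarith+
  qed
  have row: "?A $$ (r - 1, j) = (if j = 0 then 1 else 0)" if j: "j < r" for j
  proof -
    have "?A $$ (r - 1, j) = icoeff ?F (int (Suc (r - 1) * p + j) - int r)"
      by (rule Mmat_index) (use r j in auto)
    also have "\<dots> = coeff ?F (r * (p - 1) + j)"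
      unfolding S icoeff_def idx(1) using idx(2) by (simp only: if_False)
    also have "\<dots> = (if j = 0 then 1 else 0)"
      using lc degree_rpoly_power_le[of a r "p - 1"] by (auto intro!: coeff_eq_0)
    finally show ?thesis .
  qed
  \<comment> \<open>Deleting the first column raises j by one, which compensates for the change of d
    from r to r - 1 in the index.\<close>
  have del: "mat_delete ?A (r - 1) 0 = Mmat p (r - 1) ?F"
  proof (rule eq_matI)
    fix i j assume "i < dim_row (Mmat p (r - 1) ?F)" "j < dim_col (Mmat p (r - 1) ?F)"
    then have ij: "i < r - 1" "j < r - 1" by (auto simp: Mmat_def)
    have "mat_delete ?A (r - 1) 0 $$ (i, j) = ?A $$ (i, Suc j)"
      using ij by (simp add: mat_delete_def Mmat_def)
    also have "\<dots> = Mmat p (r - 1) ?F $$ (i, j)"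
      using ij by (subst (1 2) Mmat_index) (auto simp: of_nat_diff algebra_simps)
    finally show "mat_delete ?A (r - 1) 0 $$ (i, j) = Mmat p (r - 1) ?F $$ (i, j)" .
  qed (auto simp: mat_delete_def Mmat_def)
  have "Mdet p r (p - 1) r a = (\<Sum>j<r. ?A $$ (r - 1, j) * cofactor ?A (r - 1) j)"
    unfolding Mdet_def by (rule laplace_expansion_row[OF Mmat_carrier]) (use r in simp)
  also have "\<dots> = (\<Sum>j<r. if j = 0 then cofactor ?A (r - 1) 0 else 0)"
  proof (rule sum.cong)
    fix j assume "j \<in> {..<r}"
    then have "j < r" by simp
    then show "?A $$ (r - 1, j) * cofactor ?A (r - 1) j = (if j = 0 then cofactor ?A (r - 1) 0 else 0)"
      by (simp only: row) simp
  qed simp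
  also have "\<dots> = cofactor ?A (r - 1) 0" using r by simp
  also have "\<dots> = (- 1) ^ (r - 1) * Mdet p r (p - 1) (r - 1) a"
    by (simp only: cofactor_def del Mdet_def add_0_right)
  finally show ?thesis .
qed

lemma to_ac_hom: "comm_ring_hom (to_ac :: 'a::field \<Rightarrow> 'a alg_closure)"
  by unfold_locales simp_all

section \<open>Necessary and sufficient conditions over a field of characteristic p\<close>

context
  fixes p :: nat
  assumes char: "CHAR('a::field) = p" and prime: "prime p"
begin

lemma Mdet_binomial_specialisation:
  assumes "s > 0" "\<not> p dvd s" "u \<le> 1" "e < p"
  obtains a :: "nat \<Rightarrow> 'a alg_closure" where "inj_on a {..<s + u}" "rpoly a (s + u) = monom 1 u * (monom 1 s - 1)"
  by (rule binomial_splits[of p s u]) (use assms char that in auto)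

lemma exponent_bounds:
  assumes eq: "Mdet p r e d mvar = mconst (c::'a) * vdm mvar r ^ g" and c: "c \<noteq> 0"
    and rd: "r > 0" "d > 0"
  shows "e < p" and "d * p \<le> r * e + d"
proof -
  have p0: "p > 0" using prime by (simp add: prime_gt_0_nat)
  have mc: "mconst c \<noteq> 0" using c by (metis lookup_single_eq lookup_zero mconst_def)
  note nz = Mdet_nonzero_at_distinct[OF mconst_hom eq mc]
  have mv0: "mvar i \<noteq> (0 :: 'a mpoly)" for i
    by (metis lookup_single_eq lookup_zero mvar_def zero_neq_one)
  show "e < p"
  proof (rule ccontr)
    assume "\<not> e < p"
    \<comment> \<open>The roots 0, x_1, ..., x_(r-1) are still distinct, so no extension of the
      field is needed here.\<close>
    have "inj_on (mvar(0 := 0 :: 'a mpoly)) {..<r}"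
      using mv0 mv0[symmetric] by (auto simp: inj_on_def)
    from nz[OF this] show False
      using Mdet_eq_0_if_root_0[of 0 r "mvar(0 := 0 :: 'a mpoly)" p e d] rd p0 \<open>\<not> e < p\<close> by simp
  qed
  show "d * p \<le> r * e + d"
  proof (rule ccontr)
    assume "\<not> d * p \<le> r * e + d"
    moreover have "inj_on (mvar :: nat \<Rightarrow> 'a mpoly) {..<r}" by (simp add: inj_on_def)
    from nz[OF this] have "Mdet p r e d (mvar :: nat \<Rightarrow> 'a mpoly) \<noteq> 0" .
    ultimately show False using Mdet_eq_0_if_degree_small[of r e d p "mvar :: nat \<Rightarrow> 'a mpoly"] rd by simp
  qed
qed

text \<open>At the distinct roots of X^u (X^s - 1) the determinant is nonzero, so no row can vanish;
  the conclusion lists where row i can have a nonzero entry.\<close>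

lemma stable_columns:
  assumes eq: "Mdet p (s + u) e d mvar = mconst (c::'a) * vdm mvar (s + u) ^ g" and c: "c \<noteq> 0"
    and e: "e < p" and s: "s > 0" "\<not> p dvd s" and u: "u \<le> 1" and i: "i < d"
  shows "\<exists>j<d. \<exists>k\<le>e. Suc i * p + j = d + u * e + s * k"
proof -
  obtain a :: "nat \<Rightarrow> 'a alg_closure" where a: "inj_on a {..<s + u}" "rpoly a (s + u) = monom 1 u * (monom 1 s - 1)"
    using Mdet_binomial_specialisation[OF s u e] .
  have "to_ac c \<noteq> 0" using c by simp
  then have nz: "Mdet p (s + u) e d a \<noteq> 0"
    using Mdet_nonzero_at_distinct[OF to_ac_hom eq _ a(1)] by simp
  have char': "CHAR('a alg_closure) = p" using char by simp
  show ?thesis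
  proof (rule ccontr)
    assume neg: "\<not> ?thesis"
    have "Mdet p (s + u) e d a = 0"
      unfolding Mdet_def
    proof (rule det_zero_row[OF Mmat_carrier i])
      fix j assume j: "j < d"
      show "Mmat p d (rpoly a (s + u) ^ e) $$ (i, j) = 0"
        using Mmat_binomial_entry[OF char' prime e s(1) a(2) i j] neg j by blast
    qed
    with nz show False by simp
  qed
qed

lemma size_eq_pred:
  assumes eq: "Mdet p r e d mvar = mconst (c::'a) * vdm mvar r ^ g" and c: "c \<noteq> 0"
    and r: "r \<ge> 2" and e: "e \<ge> 1" and d: "d \<ge> 1" "d \<le> p" "d < r"
    and cond: "r = 2 \<or> \<not> r dvd p - 1"
  shows "d = r - 1"
proof (cases "r = 2")
  case False
  with cond have ndvd: "\<not> r dvd p - 1" by simp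
  have p2: "p \<ge> 2" using prime by (simp add: prime_ge_2_nat)
  have ep: "e < p" using exponent_bounds[OF eq c] r d by simp
  have ident: "p * d * (d + 1) + g * (r * (r - 1)) = 2 * r * e * d + d * (d + 1)"
    by (rule degree_identity[OF eq c])
  show ?thesis
  proof (cases "p dvd r")
    case False
    have cop: "coprime p r" using prime False by (simp add: prime_imp_coprime)
    show ?thesis
    proof (rule initial_segment_stable_under_mult[OF cop _ ndvd d(1,3)])
      \<comment> \<open>Row i gives ip = (d - j) + rk with 1 \<le> d - j \<le> d < r, so the residue
        of ip lies in {1..d}.\<close>
      fix i assume i: "1 \<le> i" "i \<le> d"
      have "\<exists>j<d. \<exists>k\<le>e. Suc (i - 1) * p + j = d + 0 * e + r * k"
        by (rule stable_columns[of r 0 e d c g "i - 1"]) (use eq c ep r False i in auto)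
      moreover have "Suc (i - 1) = i" using i by simp
      ultimately obtain j k where jk: "j < d" "i * p + j = d + r * k" by auto
      then have "i * p = (d - j) + r * k" by simp
      then have "i * p mod r = (d - j) mod r" by simp
      also have "\<dots> = d - j" using d by simp
      finally show "i * p mod r \<in> {1..d}" using jk by simp
    qed (use p2 in simp)
  next
    case True
    then obtain m where m: "r = p * m" by (elim dvdE)
    show ?thesis
    proof (cases "m = 1")
      case m1: True
      \<comment> \<open>For r = p the degree identity modulo p yields p | d(d+1), and d < p leaves
        only d = p - 1.\<close>
      have "p dvd p * d * (d + 1) + g * (r * (r - 1))" by (simp add: m mult.assoc)
      then have "p dvd 2 * r * e * d + d * (d + 1)" by (simp only: ident)
      moreover have "p dvd 2 * r * e * d" by (simp add: m)
      ultimately have "p dvd d * (d + 1)" by (simp only: dvd_add_right_iff)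
      then consider "p dvd d" | "p dvd d + 1" using prime prime_dvd_mult_iff by blast
      then show ?thesis
      proof cases
        case 1
        then have "p \<le> d" using d by (intro dvd_imp_le) auto
        then show ?thesis using d m m1 by simp
      next
        case 2
        then have "p \<le> d + 1" by (intro dvd_imp_le) auto
        then show ?thesis using d m m1 by simp
      qed
    next
      case False
      have "m \<noteq> 0" using m r by (cases m) auto
      with False have "2 \<le> m" by simp
      then have r2: "2 * p \<le> r" unfolding m by simp
      show ?thesis
      proof (cases "d = 1")
        case d1: True
        \<comment> \<open>For d = 1 the degree identity modulo p yields p | 2; then p = 2 and e = 1,
          and the identity fails for r \<ge> 4 whether g is zero or positive.\<close>
        have "p dvd 2 * r * e * d + d * (d + 1)"
          unfolding ident[symmetric] by (simp add: m mult.assoc)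
        moreover have "p dvd 2 * r * e * d" by (simp add: m)
        ultimately have "p dvd d * (d + 1)" by (simp only: dvd_add_right_iff)
        then have "p dvd 2" by (simp add: d1 numeral_2_eq_2)
        then have "p = 2" using p2 by (simp add: dvd_imp_le le_antisym)
        then have "e = 1" using ep e by simp
        have "4 + g * (r * (r - 1)) = 2 * r + 2"
          using ident unfolding d1 \<open>p = 2\<close> \<open>e = 1\<close> by simp
        moreover have "r * (r - 1) \<ge> 4 * (r - 1)" using r2 \<open>p = 2\<close> by (intro mult_right_mono) auto
        ultimately have False
        proof (cases g)
          case 0
          then show ?thesis using \<open>4 + g * (r * (r - 1)) = 2 * r + 2\<close> r2 \<open>p = 2\<close> by simp
        next
          case (Suc g')
          then have "g * (r * (r - 1)) \<ge> r * (r - 1)" by simp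
          then show ?thesis
            using \<open>4 + g * (r * (r - 1)) = 2 * r + 2\<close> \<open>r * (r - 1) \<ge> 4 * (r - 1)\<close> r2 \<open>p = 2\<close> by linarith
        qed
        then show ?thesis ..
      next
        case False
        then have d2: "d \<ge> 2" using d by simp
        have "\<not> p dvd r - 1"
        proof
          assume "p dvd r - 1"
          then have "p dvd r - (r - 1)" using True by (rule dvd_diff_nat[rotated])
          then show False using r p2 by simp
        qed
        moreover have r1: "r = (r - 1) + 1" using r by simp
        \<comment> \<open>The second row for X^r - X is empty: k = 0 gives at most d + e < 2p, while
          k \<ge> 1 gives at least d + e + r - 1, which exceeds 2p + j because r \<ge> 2p and j <
          d.\<close>
        ultimately have "\<exists>j<d. \<exists>k\<le>e. Suc 1 * p + j = d + 1 * e + (r - 1) * k"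
          by (intro stable_columns[of "r - 1" 1 e d c g 1]) (use eq c ep r d2 in auto)
        then obtain j k where jk: "j < d" "Suc 1 * p + j = d + 1 * e + (r - 1) * k" by blast
        then have "k \<noteq> 0" using d ep by (intro notI) simp
        then have "r - 1 \<le> (r - 1) * k" by simp
        moreover have "2 * p + j = d + e + (r - 1) * k" using jk(2) by simp
        ultimately have False using jk(1) r2 e p2 by linarith
        then show ?thesis ..
      qed
    qed
  qed
qed (use d in simp)

text \<open>The hypothesis \<open>le\<close> is r(p-1-e) \<le> p - 1 without subtraction from p. It
  serves only for the constant to be nonzero, by keeping the last row of the specialised matrix
  within the degree of f^e.\<close>

lemma Mdet_eq_const_delta_power_B0:
  assumes r: "r \<ge> 2" "r \<le> p + 1" and e: "p < 2 * e + 1" "e < p" and le: "(r - 1) * p \<le> r * e + (r - 1)"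
  obtains c :: 'a where "c \<noteq> 0" "Mdet p r e (r - 1) mvar = mconst c * vdm mvar r ^ (2 * e + 1 - p)"
proof -
  let ?d = "r - 1"
  have p2: "p \<ge> 2" using prime by (simp add: prime_ge_2_nat)
  obtain q where q: "r = q + 1" "q \<ge> 1" using r by (metis Suc_eq_plus1 Suc_le_D numeral_2_eq_2 Suc_le_mono One_nat_def)
  obtain g where g: "2 * e + 1 = p + g" using e by (metis less_imp_le le_Suc_ex)
  have "r * e + ?d < r * p"
  proof -
    have "r * (e + 1) \<le> r * p" using e by (intro mult_left_mono) auto
    then show ?thesis using r by (simp add: algebra_simps)
  qed
  then have deg: "r * e + ?d < Suc ?d * p" using r by simp
  \<comment> \<open>For d = r - 1 every term is a multiple of r(r-1), and the identity reduces to p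
    + g = 2e + 1.\<close>
  have hom: "p * ?d * (?d + 1) + g * (r * (r - 1)) = 2 * r * e * ?d + ?d * (?d + 1)"
  proof -
    have "p * q * (q + 1) + g * ((q + 1) * q) = (p + g) * (q * (q + 1))" by (simp add: algebra_simps)
    also have "\<dots> = 2 * (q + 1) * e * q + q * (q + 1)" unfolding g[symmetric] by (simp add: algebra_simps)
    finally show ?thesis by (simp add: q)
  qed
  obtain c :: 'a where c: "Mdet p r e ?d mvar = mconst c * vdm mvar r ^ g"
    using Mdet_eq_const_delta_power[OF char prime _ deg _ hom] g r by auto
  have char': "CHAR('a alg_closure) = p" using char by simp
  have "c \<noteq> 0"
  proof
    assume "c = 0"
    then have "Mdet p r e ?d (mvar :: nat \<Rightarrow> 'a mpoly) = 0" using c by (simp add: mconst_def)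
    then have zero: "Mdet p r e ?d a = 0" for a :: "nat \<Rightarrow> 'a alg_closure"
      unfolding Mdet_eval[OF to_ac_hom, symmetric]
      by (simp add: insertion_0[OF to_ac_hom])
    \<comment> \<open>At least one of r and r - 1 is prime to p; this decides between X^r - 1 and
      X^r - X.\<close>
    obtain s u where su: "r = s + u" "u = 0 \<and> ?d + 1 = s \<or> u = 1 \<and> ?d = s" "s > 0" "\<not> p dvd s"
    proof (cases "p dvd r")
      case False
      then show ?thesis using that[of r 0] r by simp
    next
      case True
      have "\<not> p dvd r - 1"
      proof
        assume "p dvd r - 1"
        then have "p dvd r - (r - 1)" using True by (rule dvd_diff_nat[rotated])
        then show False using r p2 by simp
      qed
      then show ?thesis using that[of "r - 1" 1] r by simp
    qed
    then have "u \<le> 1" by auto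
    then obtain a :: "nat \<Rightarrow> 'a alg_closure" where a: "rpoly a (s + u) = monom 1 u * (monom 1 s - 1)"
      using Mdet_binomial_specialisation[OF su(3,4)] e(2) by blast
    show False
      using Mdet_binomial_nonzero[OF char' prime e(2) su(3,4) a su(2)] zero le by (simp add: su(1))
  qed
  then show ?thesis using that[of c] c g by simp
qed

end

lemma mem_setA_iff:
  "(r, e, d) \<in> setA (P :: 'p::prime_card itself) \<longleftrightarrow> r \<ge> 2 \<and> e \<ge> 1 \<and> 1 \<le> d \<and> d \<le> CARD('p) \<and>
     (\<exists>(c::'p mod_ring) g. c \<noteq> 0 \<and> g > 0 \<and> Mdet CARD('p) r e d mvar = mconst c * vdm mvar r ^ g)"
  by (simp add: setA_def Mdet_def fpoly_eq_rpoly delta_eq_vdm)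

theorem theorem2:
  fixes P :: "'p::prime_card itself"
  shows "{(r,e,d) \<in> setA P. r = 2 \<or> \<not> r dvd (CARD('p) - 1)} =
         {(r,e,d) \<in> setB CARD('p). r = 2 \<or> \<not> r dvd (CARD('p) - 1)}"
proof -
  let ?p = "CARD('p)"
  have char: "CHAR('p mod_ring) = ?p" by simp
  have prime: "prime ?p" by (rule prime_card)
  have p2: "?p \<ge> 2" using prime by (rule prime_ge_2_nat)
  have AB: "(r, e, d) \<in> setB ?p"
    if A: "(r, e, d) \<in> setA P" and cond: "r = 2 \<or> \<not> r dvd (?p - 1)" for r e d
  proof -
    from A obtain c :: "'p mod_ring" and g where *: "r \<ge> 2" "e \<ge> 1" "1 \<le> d" "d \<le> ?p"
      and c: "c \<noteq> 0" "g > 0" and eq: "Mdet ?p r e d mvar = mconst c * vdm mvar r ^ g"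
      unfolding mem_setA_iff by blast
    have ep: "e < ?p" and dp: "d * ?p \<le> r * e + d"
      using exponent_bounds[OF char prime eq c(1)] * by simp_all
    have ident: "?p * d * (d + 1) + g * (r * (r - 1)) = 2 * r * e * d + d * (d + 1)"
      by (rule degree_identity[OF eq c(1)])
    obtain q where q: "?p = q + 1" "q \<ge> 1" using p2 by (metis Suc_eq_plus1 Suc_le_D numeral_2_eq_2 Suc_le_mono One_nat_def)
    \<comment> \<open>With q = p - 1 the chain dq \<le> re \<le> rq gives d \<le> r, and d = r
      forces e = p - 1.\<close>
    have dq: "d * q \<le> r * e" using dp by (simp add: q)
    also have "\<dots> \<le> r * q" using ep q by (intro mult_left_mono) auto
    finally have "d \<le> r" using q by simp
    show ?thesis
    proof (cases "d = r")
      case True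
      then have "q \<le> e" using dq * by simp
      then have "e = ?p - 1" using ep q by simp
      then show ?thesis using True * by (simp add: setB_def setBplus_def)
    next
      case False
      then have d: "d = r - 1"
        using size_eq_pred[OF char prime eq c(1)] * \<open>d \<le> r\<close> cond by simp
      obtain t where t: "r = t + 1" "d = t" "t \<ge> 1" using d * that[of "r - 1"] by simp
      \<comment> \<open>Dividing the degree identity by r(r-1) gives p + g = 2e + 1, so g > 0
        becomes the strict lower bound on e.\<close>
      have "(?p + g) * (t * (t + 1)) = (2 * e + 1) * (t * (t + 1))"
        using ident by (simp add: t algebra_simps)
      moreover have "t * (t + 1) \<noteq> 0" using t by simp
      ultimately have "?p + g = 2 * e + 1" by (simp only: mult_cancel2 simp_thms)
      then have "int ?p - 1 < 2 * int e" using c by linarith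
      moreover have "int r * (int ?p - 1 - int e) \<le> int ?p - 1"
      proof -
        have "int (t * q) \<le> int ((t + 1) * e)" using dq t by (simp only: of_nat_le_iff)
        then show ?thesis by (simp add: q t algebra_simps)
      qed
      ultimately show ?thesis
        using * t ep by (simp add: setB_def setB0_def)
    qed
  qed
  \<comment> \<open>The explicit constant and exponent are kept because the case e = p - 1, d = r
    reuses them for d = r - 1, up to a sign.\<close>
  have B0: "(r, e, d) \<in> setA P" "\<exists>(c::'p mod_ring) g. c \<noteq> 0 \<and> g > 0 \<and> Mdet ?p r e d mvar = mconst c * vdm mvar r ^ g"
    if B: "(r, e, d) \<in> setB0 ?p" for r e d
  proof -
    from B have *: "r \<ge> 2" "r \<le> ?p + 1" "?p < 2 * e + 1" "e < ?p" "d = r - 1"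
      and le: "int r * (int ?p - 1 - int e) \<le> int ?p - 1"
      using p2 by (auto simp: setB0_def)
    have "int ((r - 1) * ?p) \<le> int (r * e + (r - 1))"
      using le * by (simp add: of_nat_diff algebra_simps)
    then have le': "(r - 1) * ?p \<le> r * e + (r - 1)" by (simp only: of_nat_le_iff)
    obtain c :: "'p mod_ring" where "c \<noteq> 0" "Mdet ?p r e (r - 1) mvar = mconst c * vdm mvar r ^ (2 * e + 1 - ?p)"
      using Mdet_eq_const_delta_power_B0[OF char prime *(1-4) le'] .
    moreover have "2 * e + 1 - ?p > 0" using * by simp
    ultimately show ex: "\<exists>(c::'p mod_ring) g. c \<noteq> 0 \<and> g > 0 \<and> Mdet ?p r e d mvar = mconst c * vdm mvar r ^ g"
      using *(5) by blast
    show "(r, e, d) \<in> setA P"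
      unfolding mem_setA_iff using ex * p2 by auto
  qed
  have BA: "(r, e, d) \<in> setA P"
    if B: "(r, e, d) \<in> setB ?p" and cond: "r = 2 \<or> \<not> r dvd (?p - 1)" for r e d
  proof -
    from B consider "(r, e, d) \<in> setBplus ?p" | "(r, e, d) \<in> setB0 ?p" | "(r, e, d) \<in> setBminus ?p"
      by (auto simp: setB_def)
    then show ?thesis
    proof cases
      case 1
      then have *: "2 \<le> r" "r \<le> ?p" "e = ?p - 1" "d = r" by (auto simp: setBplus_def)
      then have "(r, e, r - 1) \<in> setB0 ?p" using p2 by (auto simp: setB0_def of_nat_diff)
      from B0(2)[OF this] obtain c :: "'p mod_ring" and g where c: "c \<noteq> 0" "g > 0"
        and eq: "Mdet ?p r e (r - 1) mvar = mconst c * vdm mvar r ^ g" by blast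
      interpret m: comm_ring_hom "mconst :: 'p mod_ring \<Rightarrow> 'p mod_ring mpoly" by (rule mconst_hom)
      have "Mdet ?p r e d mvar = (- 1) ^ (r - 1) * Mdet ?p r e (r - 1) (mvar :: nat \<Rightarrow> 'p mod_ring mpoly)"
        using Mdet_last_row_expansion[of r ?p "mvar :: nat \<Rightarrow> 'p mod_ring mpoly"] * p2 by simp
      also have "\<dots> = mconst ((- 1) ^ (r - 1) * c) * vdm mvar r ^ g"
        by (simp only: eq m.hom_mult m.hom_power m.hom_uminus m.hom_one mult.assoc)
      finally show ?thesis
        unfolding mem_setA_iff using * c p2
        by (intro conjI exI[of _ "(- 1) ^ (r - 1) * c"] exI[of _ g]) auto
    next
      case 2
      then show ?thesis by (rule B0(1))
    next
      case 3
      then have *: "r \<ge> 2" "int ?p - 1 < 2 * int e" "int r * (int ?p - 1 - int e) = int ?p - 1"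
        by (auto simp: setBminus_def)
      \<comment> \<open>The equation makes r a divisor of p - 1, so only r = 2 is left; then 2e = p
        - 1, against the strict bound on e.\<close>
      then have "int r dvd int (?p - 1)" using p2 by (metis dvd_triv_left of_nat_1 of_nat_diff one_le_numeral order_trans)
      then have "r dvd ?p - 1" by (simp only: of_nat_dvd_iff)
      with cond have "r = 2" by blast
      with * have False by simp
      then show ?thesis ..
    qed
  qed
  show ?thesis using AB BA by auto
qed

end
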